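(* Let $\mathcal{C}\subseteq\mathbb{A}^n$ be a smooth algebraic curve having a polynomial parametric representation $\mathcal{P}=(g_1,\dots,g_n):\mathbb{A}^1\to\mathcal{C}$, with $g_1,\dots,g_n\in K[t]$, for which there is a non-empty Zariski open subset $\mathcal{U}\subseteq\mathbb{A}^1$ such that (P1) $\mathcal{P}:\mathcal{U}\to\mathcal{C}$ is injective, and (P2) the derivative $\mathcal{P}'(t)$ does not vanish for every $t\in\mathcal{U}$. Then $$\deg(T\mathcal{C})=2\deg(\mathcal{C})-1.$$
   Context: $K$ is an algebraically closed field of characteristic $0$ and $\mathbb{A}^n$ is $K^n$ with the Zariski topology. An algebraic variety is a Zariski closed subset. A curve $\mathcal{C}\subseteq\mathbb{A}^n$ has a polynomial parametric representation if there are $g_1,\dots,g_n\in K[t]$ such that $t\mapsto(g_1(t),\dots,g_n(t))$ defines a dominant map $\mathbb{A}^1\to\mathcal{C}$ (its image is contained in $\mathcal{C}$ and Zariski dense in $\mathcal{C}$); such a curve is irreducible. Geometric degree: if $V\subseteq\mathbb{A}^n$ is irreducible of dimension $d$, then $\deg(V)$ is the cardinality of $V\cap L$ for a generic affine linear variety $L\subseteq \mathbb{A}^n$ of dimension $n-d$. Tangent bundle: for a smooth variety $V\subseteq \mathbb{A}^n$ with vanishing ideal $I(V)=(f_1,\dots,f_r)\subseteq K[x_1,\dots,x_n]$, $T_pV=\{y\in \mathbb{A}^n\mid \nabla f_i(p)\cdot y=0,\ 1\le i\le r\}$ for $p\in V$, and $TV=\{(x,y)\in\mathbb{A}^{2n}\mid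 x\in V,\ y\in T_xV\}$. *)

theory Defs
  imports
    "HOL-Analysis.Analysis"
    "HOL-Library.Poly_Mapping"
    "HOL-Library.Extended_Nat"
    "HOL-Computational_Algebra.Polynomial"
begin

section \<open>Multivariate polynomials\<close>

text \<open>A polynomial is a finitely supported map from exponent vectors (themselves finitely
  supported) to coefficients. The index type of the variables may be infinite, but every
  polynomial involves only finitely many of them.\<close>

type_synonym ('v, 'a) mpoly = "('v \<Rightarrow>\<^sub>0 nat) \<Rightarrow>\<^sub>0 'a"

definition mono_eval :: "('v \<Rightarrow>\<^sub>0 nat) \<Rightarrow> ('v \<Rightarrow> 'a) \<Rightarrow> 'a::comm_semiring_1" where
  "mono_eval m x = (\<Prod>i\<in>Poly_Mapping.keys m. x i ^ Poly_Mapping.lookup m i)"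

definition mpoly_eval :: "('v, 'a) mpoly \<Rightarrow> ('v \<Rightarrow> 'a) \<Rightarrow> 'a::comm_semiring_1" where
  "mpoly_eval p x = (\<Sum>m\<in>Poly_Mapping.keys p. Poly_Mapping.lookup p m * mono_eval m x)"

definition indets :: "('v, 'a::zero) mpoly \<Rightarrow> 'v set" where
  "indets p = (\<Union>m\<in>Poly_Mapping.keys p. Poly_Mapping.keys m)"

text \<open>The formal partial derivative. The truncated difference of exponents is harmless, because
  the coefficient vanishes when the exponent of the variable is zero.\<close>

definition partial :: "'v \<Rightarrow> ('v, 'a) mpoly \<Rightarrow> ('v, 'a::comm_semiring_1) mpoly" where
  "partial i p = (\<Sum>m\<in>Poly_Mapping.keys p.
     Poly_Mapping.single (m - Poly_Mapping.single i 1)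
       (of_nat (Poly_Mapping.lookup m i) * Poly_Mapping.lookup p m))"

lemma mpoly_induct [case_names zero add single]:
  fixes p :: "('v, 'a::comm_monoid_add) mpoly"
  assumes "P 0" and "\<And>p q. P p \<Longrightarrow> P q \<Longrightarrow> P (p + q)"
    and "\<And>m c. P (Poly_Mapping.single m c)"
  shows "P p"
proof (induction p rule: update_induct)
  case const
  show ?case using assms(1) by simp
next
  case (update f a b)
  have "Poly_Mapping.update a b f = Poly_Mapping.single a b + f"
    using update by (intro poly_mapping_eqI)
      (auto simp: lookup_update lookup_add lookup_single in_keys_iff when_def)
  then show ?case using update assms by simp
qed

lemma mpoly_eval_0 [simp]: "mpoly_eval 0 x = 0"
  by (simp add: mpoly_eval_def)

lemma mpoly_eval_add: "mpoly_eval (p + q) x = mpoly_eval p x + mpoly_eval q x"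
  unfolding mpoly_eval_def by (rule setsum_keys_plus_distrib) (auto simp: algebra_simps)

lemma mpoly_eval_single [simp]:
  "mpoly_eval (Poly_Mapping.single m c) x = c * mono_eval m x"
  by (simp add: mpoly_eval_def)

lemma mono_eval_add: "mono_eval (m + n) x = mono_eval m x * mono_eval n x"
proof -
  have *: "mono_eval k x = (\<Prod>i\<in>A. x i ^ Poly_Mapping.lookup k i)"
    if "finite A" "Poly_Mapping.keys k \<subseteq> A" for k A
    unfolding mono_eval_def using that by (intro prod.mono_neutral_left) (auto simp: in_keys_iff)
  let ?A = "Poly_Mapping.keys m \<union> Poly_Mapping.keys n"
  have "Poly_Mapping.keys (m + n) \<subseteq> ?A" by (rule keys_add)
  then show ?thesis
    by (simp add: *[where A = ?A] lookup_add power_add prod.distrib)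
qed

lemma mpoly_eval_mult: "mpoly_eval (p * q) x = mpoly_eval p x * mpoly_eval q x"
proof (induction p rule: mpoly_induct)
  case (single m c)
  show ?case
    by (induction q rule: mpoly_induct)
      (simp_all add: mult_single mono_eval_add mpoly_eval_add algebra_simps)
qed (simp_all add: mpoly_eval_add algebra_simps)

lemma mpoly_eval_1 [simp]: "mpoly_eval 1 x = 1"
  using mpoly_eval_single[of 0 1 x] by (simp add: mono_eval_def del: mpoly_eval_single)

lemma partial_0 [simp]: "partial i 0 = 0"
  by (simp add: partial_def)

lemma partial_add: "partial i (p + q) = partial i p + partial i q"
  unfolding partial_def
  by (rule setsum_keys_plus_distrib) (auto simp: algebra_simps simp flip: single_add)

lemma partial_single:
  "partial i (Poly_Mapping.single m c) =
     Poly_Mapping.single (m - Poly_Mapping.single i 1) (of_nat (Poly_Mapping.lookup m i) * c)"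
  by (simp add: partial_def)

lemma partial_mult: "partial i (p * q) = partial i p * q + p * partial i q"
proof (induction p rule: mpoly_induct)
  case (single m c)
  show ?case
  proof (induction q rule: mpoly_induct)
    case (single n d)
    let ?e = "Poly_Mapping.single i (1::nat)"
    have *: "Poly_Mapping.single (k + l - ?e) (of_nat (Poly_Mapping.lookup k i) * a) =
        Poly_Mapping.single ((k - ?e) + l) (of_nat (Poly_Mapping.lookup k i) * a)"
      for k l and a :: 'b
    proof (cases "Poly_Mapping.lookup k i = 0")
      case False
      then have "k + l - ?e = (k - ?e) + l"
        by (intro poly_mapping_eqI)
          (auto simp: lookup_add lookup_minus lookup_single when_def)
      then show ?thesis by simp
    qed simp
    show ?case
      using *[of m n "c * d"] *[of n m "c * d"]
      by (simp add: partial_single mult_single lookup_add ring_distribs single_add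
          add.commute mult.assoc mult.commute mult.left_commute)
  qed (simp_all add: partial_add algebra_simps)
qed (simp_all add: partial_add algebra_simps)


section \<open>The Zariski topology on affine space\<close>

definition zero_set :: "('n, 'k) mpoly set \<Rightarrow> ('k::field ^ 'n) set" where
  "zero_set S = {x. \<forall>p\<in>S. mpoly_eval p (($) x) = 0}"

definition zariski :: "('k::field ^ 'n) topology" where
  "zariski = topology (\<lambda>U. \<exists>S. U = - zero_set S)"

lemma openin_zariski: "openin zariski U \<longleftrightarrow> (\<exists>S. U = - zero_set S)"
proof -
  have "istopology (\<lambda>U :: ('k::field ^ 'n) set. \<exists>S. U = - zero_set S)"
    unfolding istopology_def
  proof (intro conjI allI impI)
    fix U V :: "('k ^ 'n) set"
    assume "\<exists>S. U = - zero_set S" "\<exists>S. V = - zero_set S"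
    then obtain S T where "U = - zero_set S" "V = - zero_set T" by blast
    then have "U \<inter> V = - zero_set {p * q | p q. p \<in> S \<and> q \<in> T}"
      by (fastforce simp: zero_set_def mpoly_eval_mult)
    then show "\<exists>S. U \<inter> V = - zero_set S" by blast
  next
    fix \<K> :: "('k ^ 'n) set set"
    assume "\<forall>K\<in>\<K>. \<exists>S. K = - zero_set S"
    then obtain S where S: "\<And>K. K \<in> \<K> \<Longrightarrow> K = - zero_set (S K)" by metis
    have "\<Union>\<K> = (\<Union>K\<in>\<K>. - zero_set (S K))" using S by blast
    also have "\<dots> = - zero_set (\<Union>K\<in>\<K>. S K)" by (auto simp: zero_set_def)
    finally show "\<exists>S. \<Union>\<K> = - zero_set S" by blast
  qed
  then show ?thesis unfolding zariski_def by (subst topology_inverse') auto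
qed

lemma topspace_zariski [simp]: "topspace zariski = UNIV"
proof -
  have "openin zariski (- zero_set {1})" by (auto simp: openin_zariski)
  then show ?thesis by (auto simp: zero_set_def dest: openin_subset)
qed

lemma closedin_zariski: "closedin zariski V \<longleftrightarrow> (\<exists>S. V = zero_set S)"
  by (auto simp: closedin_def openin_zariski Compl_eq_Diff_UNIV [symmetric])

definition vanishing_ideal :: "('k::field ^ 'n) set \<Rightarrow> ('n, 'k) mpoly set" where
  "vanishing_ideal V = {p. \<forall>x\<in>V. mpoly_eval p (($) x) = 0}"

definition irreducible_variety :: "('k::field ^ 'n) set \<Rightarrow> bool" where
  "irreducible_variety V \<longleftrightarrow> closedin zariski V \<and> V \<noteq> {} \<and>
     (\<forall>A B. closedin zariski A \<and> closedin zariski B \<and> V = A \<union> B \<longrightarrow> V = A \<or> V = B)"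

text \<open>Krull dimension: the supremum of the lengths \<open>k\<close> of chains
  \<open>Z\<^sub>0 \<subset> \<dots> \<subset> Z\<^sub>k\<close> of irreducible closed subsets.\<close>

definition dimension :: "('k::field ^ 'n) set \<Rightarrow> enat" where
  "dimension V = Sup {enat k | k. \<exists>Z. (\<forall>i\<le>k. irreducible_variety (Z i) \<and> Z i \<subseteq> V) \<and>
     (\<forall>i<k. Z i \<subset> Z (Suc i))}"

definition local_dimension :: "('k::field ^ 'n) set \<Rightarrow> 'k ^ 'n \<Rightarrow> enat" where
  "local_dimension V p = (SUP Z\<in>{Z. irreducible_variety Z \<and> Z \<subseteq> V \<and> p \<in> Z}. dimension Z)"


section \<open>Tangent spaces\<close>

definition tangent_space :: "('k::field ^ 'n) set \<Rightarrow> 'k ^ 'n \<Rightarrow> ('k ^ 'n) set" where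
  "tangent_space V p =
     {y. \<forall>f\<in>vanishing_ideal V. (\<Sum>i\<in>UNIV. mpoly_eval (partial i f) (($) p) * y $ i) = 0}"

text \<open>The gradients of any generating set of the vanishing ideal cut out the same space.\<close>

lemma tangent_space_generators:
  fixes V :: "('k::field ^ 'n) set"
  assumes gen: "module.span (*) F = vanishing_ideal V" and p: "p \<in> V"
  shows "tangent_space V p =
     {y. \<forall>f\<in>F. (\<Sum>i\<in>UNIV. mpoly_eval (partial i f) (($) p) * y $ i) = 0}"
proof -
  interpret m: module "(*) :: ('n, 'k) mpoly \<Rightarrow> _"
    by unfold_locales (auto simp: algebra_simps)
  have F: "F \<subseteq> vanishing_ideal V" using gen m.span_superset by metis
  have "(\<Sum>i\<in>UNIV. mpoly_eval (partial i f) (($) p) * y $ i) = 0"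
    if f: "f \<in> vanishing_ideal V"
      and y: "\<forall>f\<in>F. (\<Sum>i\<in>UNIV. mpoly_eval (partial i f) (($) p) * y $ i) = 0" for f y
    using f unfolding gen[symmetric]
  proof (induction rule: m.span_induct_alt)
    case base
    show ?case by simp
  next
    case (step c g h)
    have "mpoly_eval g (($) p) = 0" using step F p by (auto simp: vanishing_ideal_def)
    then have "(\<Sum>i\<in>UNIV. mpoly_eval (partial i (c * g + h)) (($) p) * y $ i) =
        mpoly_eval c (($) p) * (\<Sum>i\<in>UNIV. mpoly_eval (partial i g) (($) p) * y $ i) +
        (\<Sum>i\<in>UNIV. mpoly_eval (partial i h) (($) p) * y $ i)"
      by (simp add: partial_add partial_mult mpoly_eval_add mpoly_eval_mult distrib_right
          sum.distrib sum_distrib_left mult.assoc)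
    then show ?case using step y by simp
  qed
  then show ?thesis using F by (auto simp: tangent_space_def)
qed

definition smooth_variety :: "('k::field ^ 'n) set \<Rightarrow> bool" where
  "smooth_variety V \<longleftrightarrow> closedin zariski V \<and>
     (\<forall>p\<in>V. enat (vec.dim (tangent_space V p)) = local_dimension V p)"

text \<open>The affine space of dimension \<open>2n\<close> is indexed by \<open>'n + 'n\<close>: the left summand carries the
  base point, the right summand the tangent vector.\<close>

definition tangent_bundle :: "('k::field ^ 'n) set \<Rightarrow> ('k ^ ('n + 'n)) set" where
  "tangent_bundle V =
     {z. (\<chi> i. z $ Inl i) \<in> V \<and> (\<chi> i. z $ Inr i) \<in> tangent_space V (\<chi> i. z $ Inl i)}"


section \<open>Geometric degree\<close>

definition affine_linear_variety :: "nat \<Rightarrow> ('k::field ^ 'n) set \<Rightarrow> bool" where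
  "affine_linear_variety m L \<longleftrightarrow>
     (\<exists>a W. vec.subspace W \<and> vec.dim W = m \<and> L = (\<lambda>w. a + w) ` W)"

text \<open>The solution set of \<open>d\<close> affine linear equations with coefficients \<open>c (i, Some j)\<close> and
  right-hand sides \<open>c (i, None)\<close>, where \<open>i < d\<close>.\<close>

definition linear_system :: "nat \<Rightarrow> (nat \<times> 'n option \<Rightarrow> 'k) \<Rightarrow> ('k::field ^ 'n) set" where
  "linear_system d c = {x. \<forall>i<d. (\<Sum>j\<in>UNIV. c (i, Some j) * x $ j) = c (i, None)}"

text \<open>A property holds for a generic affine linear variety of codimension \<open>d\<close> if it holds for all
  those given by \<open>d\<close> equations whose coefficients lie in some non-empty Zariski open subset of the
  space of coefficients; over an infinite field one may take a basic open set \<open>F \<noteq> 0\<close>.\<close>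

definition generic_affine_linear :: "nat \<Rightarrow> (('k::field ^ 'n) set \<Rightarrow> bool) \<Rightarrow> bool" where
  "generic_affine_linear d P \<longleftrightarrow>
     (\<exists>F :: (nat \<times> 'n option, 'k) mpoly. F \<noteq> 0 \<and> indets F \<subseteq> {..<d} \<times> UNIV \<and>
        (\<forall>c. mpoly_eval F c \<noteq> 0 \<and> affine_linear_variety (CARD('n) - d) (linear_system d c)
             \<longrightarrow> P (linear_system d c)))"

definition geometric_degree :: "('k::field ^ 'n) set \<Rightarrow> nat" where
  "geometric_degree V = (THE k. \<exists>d. irreducible_variety V \<and> dimension V = enat d \<and>
     generic_affine_linear d (\<lambda>L. finite (V \<inter> L) \<and> card (V \<inter> L) = k))"


section \<open>Curves with a polynomial parametric representation\<close>

definition smooth_curve :: "('k::field ^ 'n) set \<Rightarrow> bool" where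
  "smooth_curve C \<longleftrightarrow> smooth_variety C \<and> dimension C = 1"

text \<open>The affine line is the type \<open>'k ^ 1\<close>.\<close>

definition param :: "'k poly ^ 'n \<Rightarrow> 'k::field ^ 1 \<Rightarrow> 'k ^ 'n" where
  "param g t = (\<chi> i. poly (g $ i) (t $ 1))"

definition param_deriv :: "'k poly ^ 'n \<Rightarrow> 'k::field ^ 1 \<Rightarrow> 'k ^ 'n" where
  "param_deriv g t = (\<chi> i. poly (pderiv (g $ i)) (t $ 1))"

definition polynomial_parametrization :: "'k::field poly ^ 'n \<Rightarrow> ('k ^ 'n) set \<Rightarrow> bool" where
  "polynomial_parametrization g C \<longleftrightarrow>
     range (param g) \<subseteq> C \<and> zariski closure_of range (param g) = C"

end

theory Submission
  imports Defs
begin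

text \<open>
Let \<open>D\<close> be the largest degree of a coordinate of \<open>\<gamma>(t) = (g\<^sub>1(t), \<dots>, g\<^sub>n(t))\<close>. Both degrees are numbers
of roots of one univariate polynomial. A hyperplane meets the curve where a combination
\<open>\<Sum>i. a\<^sub>i g\<^sub>i - a\<^sub>0\<close> vanishes; generically it has \<open>D\<close> simple roots, all of them in the set where \<open>\<gamma>\<close>
is injective, so \<open>deg C = D\<close> (\<open>degree_curve\<close>). The tangent bundle is the set of points
\<open>(\<gamma>(t), s \<gamma>'(t))\<close>, on which two affine linear equations read \<open>A\<^sub>0(t) + s V\<^sub>0(t) = 0\<close> and
\<open>A\<^sub>1(t) + s V\<^sub>1(t) = 0\<close> with \<open>deg A\<^sub>i \<le> D\<close> and \<open>deg V\<^sub>i \<le> D - 1\<close>. Eliminating \<open>s\<close> leaves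
\<open>A\<^sub>0 V\<^sub>1 - A\<^sub>1 V\<^sub>0 = 0\<close>, generically an equation of degree \<open>2D - 1\<close> with simple roots
(\<open>degree_tangent_surface\<close>).

Smoothness enters in showing that \<open>\<gamma>'\<close> vanishes nowhere (\<open>immersion_at_smooth_point\<close>); without
it the tangent bundle is not the set above, and the common zeros of \<open>V\<^sub>0\<close> and \<open>V\<^sub>1\<close> would be lost
from the count. Fix \<open>t\<^sub>0\<close>. Since the cotangent space at \<open>\<gamma>(t\<^sub>0)\<close> is one-dimensional, every element
of the coordinate ring \<open>K[g\<^sub>1, \<dots>, g\<^sub>n]\<close> is, to any order at \<open>t\<^sub>0\<close>, a polynomial in a single element
\<open>u\<close>, and so its vanishing order at \<open>t\<^sub>0\<close> is a multiple of that of \<open>u\<close>. On the other hand generic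
injectivity puts \<open>t\<close> into the fraction field of the coordinate ring
(\<open>parameter_in_fraction_field\<close>), so some two elements have consecutive orders. Hence \<open>u\<close> has a
simple zero at \<open>t\<^sub>0\<close>.

Two tools supply the geometry. A statement holds generically if it holds wherever some nonzero
polynomial does not vanish; such statements are closed under conjunction, so each genericity
condition may be checked at a parameter of its own. The condition that two polynomials have no
common root is generic as soon as it holds once (\<open>elimination\<close>). The same lemma shows that the
image of \<open>\<gamma>\<close> is closed, so that it is the whole curve. The dimension of the tangent
bundle is at most two because a longer chain of irreducible subsets would give three algebraically
independent regular functions, whereas any three polynomials in \<open>t\<close> and \<open>s\<close> are algebraically
dependent.
\<close>

section \<open>Polynomial functions\<close>

text \<open>The set \<open>I\<close> records which variables may occur, as genericity conditions on linear systems have to be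
  expressed in the coefficients of the given number of equations.\<close>

definition polyfun :: "'v set \<Rightarrow> (('v \<Rightarrow> 'a) \<Rightarrow> 'a::comm_ring_1) \<Rightarrow> bool" where
  "polyfun I F \<longleftrightarrow> (\<exists>f. indets f \<subseteq> I \<and> F = mpoly_eval f)"

lemma polyfun_const [intro, simp]: "polyfun I (\<lambda>_. a)"
  unfolding polyfun_def
  by (intro exI[of _ "Poly_Mapping.single 0 a"]) (auto simp: indets_def fun_eq_iff mono_eval_def split: if_splits)

lemma polyfun_var [intro]: "i \<in> I \<Longrightarrow> polyfun I (\<lambda>c. c i)"
  unfolding polyfun_def
  by (intro exI[of _ "Poly_Mapping.single (Poly_Mapping.single i 1) 1"])
    (auto simp: indets_def fun_eq_iff mono_eval_def)

lemma polyfun_add [intro]: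
  assumes "polyfun I F" "polyfun I G" shows "polyfun I (\<lambda>c. F c + G c)"
proof -
  obtain f g where "indets f \<subseteq> I" "F = mpoly_eval f" "indets g \<subseteq> I" "G = mpoly_eval g"
    using assms unfolding polyfun_def by blast
  moreover have "indets (f + g) \<subseteq> indets f \<union> indets g"
    using keys_add[of f g] unfolding indets_def by blast
  ultimately show ?thesis unfolding polyfun_def
    by (intro exI[of _ "f + g"]) (auto simp: mpoly_eval_add fun_eq_iff)
qed

lemma polyfun_mult [intro]:
  assumes "polyfun I F" "polyfun I G" shows "polyfun I (\<lambda>c. F c * G c)"
proof -
  obtain f g where "indets f \<subseteq> I" "F = mpoly_eval f" "indets g \<subseteq> I" "G = mpoly_eval g"
    using assms unfolding polyfun_def by blast
  moreover have "indets (f * g) \<subseteq> indets f \<union> indets g"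
  proof
    fix v assume "v \<in> indets (f * g)"
    then obtain m where "m \<in> Poly_Mapping.keys (f * g)" "v \<in> Poly_Mapping.keys m"
      by (auto simp: indets_def)
    moreover obtain a b where "m = a + b" "a \<in> Poly_Mapping.keys f" "b \<in> Poly_Mapping.keys g"
      using keys_mult[of f g] \<open>m \<in> _\<close> by blast
    ultimately show "v \<in> indets f \<union> indets g"
      using keys_add[of a b] by (auto simp: indets_def)
  qed
  ultimately show ?thesis unfolding polyfun_def
    by (intro exI[of _ "f * g"]) (auto simp: mpoly_eval_mult fun_eq_iff)
qed

lemma polyfun_uminus [intro]: "polyfun I F \<Longrightarrow> polyfun I (\<lambda>c. - F c)"
  using polyfun_mult[OF polyfun_const[of I "-1"]] by fastforce

lemma polyfun_diff [intro]:
  "polyfun I F \<Longrightarrow> polyfun I G \<Longrightarrow> polyfun I (\<lambda>c. F c - G c)"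
  using polyfun_add[OF _ polyfun_uminus] by fastforce

lemma polyfun_sum [intro]:
  "(\<And>i. i \<in> S \<Longrightarrow> polyfun I (F i)) \<Longrightarrow> polyfun I (\<lambda>c. \<Sum>i\<in>S. F i c)"
  by (induction S rule: infinite_finite_induct) auto

lemma polyfun_power [intro]: "polyfun I F \<Longrightarrow> polyfun I (\<lambda>c. F c ^ k)"
  by (induction k) auto

lemmas polyfun_intros = polyfun_const polyfun_var UNIV_I polyfun_add polyfun_diff polyfun_uminus
  polyfun_mult polyfun_power polyfun_sum

lemma polyfun_mpoly_eval [intro]: "polyfun UNIV (mpoly_eval f)"
  by (auto simp: polyfun_def)

text \<open>Induction along the ring structure: identities between maps that respect addition and multiplication
  only have to be checked on constants and variables.\<close>

lemma mpoly_ring_induct [case_names const var add mult]: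
  fixes f :: "('v, 'a::comm_ring_1) mpoly"
  assumes const: "\<And>a. P (Poly_Mapping.single 0 a)"
    and var: "\<And>i. P (Poly_Mapping.single (Poly_Mapping.single i 1) 1)"
    and add: "\<And>p q. P p \<Longrightarrow> P q \<Longrightarrow> P (p + q)"
    and mult: "\<And>p q. P p \<Longrightarrow> P q \<Longrightarrow> P (p * q)"
  shows "P f"
proof (induction f rule: mpoly_induct)
  case zero
  show ?case using const[of 0] by simp
next
  case (single m c)
  have pow: "P (Poly_Mapping.single (Poly_Mapping.single i k) 1)" for i :: 'v and k
  proof (induction k)
    case 0
    show ?case using const[of 1] by simp
  next
    case (Suc k)
    show ?case using mult[OF var[of i] Suc] by (simp add: mult_single single_add[symmetric])
  qed
  have "P (Poly_Mapping.single m 1)"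
  proof (induction m rule: update_induct)
    case const
    show ?case using assms(1)[of 1] by simp
  next
    case (update f a b)
    have "Poly_Mapping.update a b f = Poly_Mapping.single a b + f"
      using update by (intro poly_mapping_eqI)
        (auto simp: lookup_update lookup_add lookup_single in_keys_iff when_def)
    then show ?case using mult[OF pow[of a b] update(3)] by (simp add: mult_single)
  qed
  from mult[OF const[of c] this] show ?case by (simp add: mult_single)
qed (use add in auto)

lemma mono_eval_0 [simp]: "mono_eval 0 x = 1"
  and mono_eval_var [simp]: "mono_eval (Poly_Mapping.single i (Suc 0)) x = x i"
  by (simp_all add: mono_eval_def)

lemma polyfun_subst:
  assumes "\<And>i. polyfun I (\<lambda>c. X c i)"
  shows "polyfun I (\<lambda>c. mpoly_eval f (X c))"
proof (induction f rule: mpoly_ring_induct)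
  case (var i)
  then show ?case using assms by simp
qed (auto simp: mpoly_eval_add mpoly_eval_mult)

section \<open>Restriction of polynomials to parametrized curves\<close>

text \<open>The image of \<open>f\<close> under the homomorphism of \<open>K\<close>-algebras that sends the variable \<open>i\<close> to \<open>g i\<close>.\<close>

definition pull :: "('v \<Rightarrow> 'a poly) \<Rightarrow> ('v, 'a) mpoly \<Rightarrow> 'a::field_char_0 poly" where
  "pull g f = (\<Sum>m\<in>Poly_Mapping.keys f. smult (Poly_Mapping.lookup f m) (mono_eval m g))"

lemma poly_pull: "poly (pull g f) t = mpoly_eval f (\<lambda>i. poly (g i) t)"
  by (simp add: pull_def mpoly_eval_def mono_eval_def poly_sum poly_prod)

lemma pull_add: "pull g (p + q) = pull g p + pull g q"
  and pull_mult: "pull g (p * q) = pull g p * pull g q"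
  and pull_const [simp]: "pull g (Poly_Mapping.single 0 a) = [:a:]"
  and pull_var [simp]: "pull g (Poly_Mapping.single (Poly_Mapping.single i (Suc 0)) 1) = g i"
  by (simp_all add: poly_eq_poly_eq_iff[symmetric] fun_eq_iff poly_pull mpoly_eval_add mpoly_eval_mult
      mono_eval_def)

lemma pull_eq_0_iff: "pull g f = 0 \<longleftrightarrow> (\<forall>t. mpoly_eval f (\<lambda>i. poly (g i) t) = 0)"
  by (simp add: poly_eq_poly_eq_iff[symmetric] fun_eq_iff poly_pull)

section \<open>Generic properties\<close>

lemma mono_eval_mult: "mono_eval m (\<lambda>i. c i * d i) = mono_eval m c * mono_eval m d"
  by (simp add: mono_eval_def power_mult_distrib prod.distrib)

text \<open>Dedekind's independence of characters: monomials are multiplicative functions, so comparing a relation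
  at the points \<open>d * c\<close> and \<open>c\<close> removes one of them from the relation.\<close>

lemma monomials_independent:
  fixes a :: "('v \<Rightarrow>\<^sub>0 nat) \<Rightarrow> 'a::field_char_0"
  assumes "finite S" "\<And>c. (\<Sum>m\<in>S. a m * mono_eval m c) = 0" "m \<in> S"
  shows "a m = 0"
  using assms
proof (induction S arbitrary: a m rule: finite_induct)
  case (insert m0 S)
  have *: "a m1 = 0" if m1: "m1 \<in> S" for m1
  proof -
    have "m1 \<noteq> m0" using insert m1 by blast
    then obtain i where i: "Poly_Mapping.lookup m1 i \<noteq> Poly_Mapping.lookup m0 i"
      using poly_mapping_eqI[of m1 m0] by auto
    \<comment> \<open>The powers of 2 are distinct in characteristic zero, so this point tells the two monomials apart.\<close>
    let ?d = "\<lambda>j. if j = i then 2 else 1 :: 'a"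
    have ev: "mono_eval m ?d = 2 ^ Poly_Mapping.lookup m i" for m :: "'v \<Rightarrow>\<^sub>0 nat"
    proof (cases "i \<in> Poly_Mapping.keys m")
      case True
      then have "mono_eval m ?d = ?d i ^ Poly_Mapping.lookup m i *
          (\<Prod>j\<in>Poly_Mapping.keys m - {i}. ?d j ^ Poly_Mapping.lookup m j)"
        unfolding mono_eval_def by (intro prod.remove) auto
      also have "(\<Prod>j\<in>Poly_Mapping.keys m - {i}. ?d j ^ Poly_Mapping.lookup m j) = 1"
        by (intro prod.neutral) auto
      finally show ?thesis by simp
    next
      case False
      then have "mono_eval m ?d = 1" unfolding mono_eval_def by (intro prod.neutral) auto
      then show ?thesis using False by (simp add: in_keys_iff)
    qed
    have inj: "(2::'a) ^ k = 2 ^ l \<longleftrightarrow> k = l" for k l :: nat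
    proof -
      have "(2::'a) ^ k = 2 ^ l \<longleftrightarrow> of_nat (2 ^ k) = (of_nat (2 ^ l) :: 'a)" by simp
      also have "\<dots> \<longleftrightarrow> k = l" unfolding of_nat_eq_iff by simp
      finally show ?thesis .
    qed
    have "(\<Sum>m\<in>S. (a m * (mono_eval m ?d - mono_eval m0 ?d)) * mono_eval m c) = 0" for c
    proof -
      have "0 = (\<Sum>m\<in>insert m0 S. a m * mono_eval m (\<lambda>j. ?d j * c j)) -
          mono_eval m0 ?d * (\<Sum>m\<in>insert m0 S. a m * mono_eval m c)"
        using insert.prems by simp
      also have "\<dots> = (\<Sum>m\<in>S. (a m * (mono_eval m ?d - mono_eval m0 ?d)) * mono_eval m c)"
        unfolding mono_eval_mult using insert.hyps
        by (simp add: algebra_simps sum_distrib_left sum_distrib_right sum_subtractf)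
      finally show ?thesis by simp
    qed
    from insert.IH[OF this m1] show ?thesis using i inj by (simp add: ev)
  qed
  have "a m0 = 0"
    using insert.prems(1)[of "\<lambda>_. 1"] insert.hyps * by (simp add: mono_eval_def)
  then show ?case using * insert.prems by auto
qed simp

text \<open>Hence a formal polynomial other than \<open>0\<close> defines a nonempty open set.\<close>

lemma mpoly_eval_nonzero:
  fixes f :: "('v, 'a::field_char_0) mpoly"
  assumes "f \<noteq> 0" shows "\<exists>c. mpoly_eval f c \<noteq> 0"
proof (rule ccontr)
  assume "\<not> ?thesis"
  then have "Poly_Mapping.lookup f m = 0" if "m \<in> Poly_Mapping.keys f" for m
    using monomials_independent[of "Poly_Mapping.keys f" "Poly_Mapping.lookup f" m] that
    by (auto simp: mpoly_eval_def)
  then have "Poly_Mapping.keys f = {}" by (metis in_keys_iff equals0I)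
  then show False using assms by simp
qed

text \<open>The property holds on a nonempty basic open set of the space of parameters.\<close>

definition generic :: "'v set \<Rightarrow> (('v \<Rightarrow> 'a::field_char_0) \<Rightarrow> bool) \<Rightarrow> bool" where
  "generic I P \<longleftrightarrow> (\<exists>F c0. polyfun I F \<and> F c0 \<noteq> 0 \<and> (\<forall>c. F c \<noteq> 0 \<longrightarrow> P c))"

lemma generic_polyfun: "polyfun I F \<Longrightarrow> F c0 \<noteq> 0 \<Longrightarrow> generic I (\<lambda>c. F c \<noteq> 0)"
  unfolding generic_def by blast

lemma generic_ex: "generic I P \<Longrightarrow> \<exists>c. P c"
  unfolding generic_def by blast

lemma generic_mono: "generic I P \<Longrightarrow> (\<And>c. P c \<Longrightarrow> Q c) \<Longrightarrow> generic I Q"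
  unfolding generic_def by blast

text \<open>Nonempty open sets of affine space meet: on the line through a point of the one and a point of the other,
  both polynomials restrict to nonzero polynomials in one variable.\<close>

lemma polyfun_common_nonzero:
  fixes F :: "('v \<Rightarrow> 'a::field_char_0) \<Rightarrow> 'a"
  assumes "polyfun I F" "polyfun J G" "F a \<noteq> 0" "G b \<noteq> 0"
  shows "\<exists>c. F c \<noteq> 0 \<and> G c \<noteq> 0"
proof -
  obtain f g where f: "F = mpoly_eval f" and g: "G = mpoly_eval g"
    using assms unfolding polyfun_def by blast
  let ?l = "\<lambda>i. [:a i, b i - a i:]"
  have "poly (pull ?l f) 0 \<noteq> 0" "poly (pull ?l g) 1 \<noteq> 0"
    unfolding poly_pull using assms f g by simp_all
  then have "pull ?l f * pull ?l g \<noteq> 0" by auto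
  then obtain t where "poly (pull ?l f * pull ?l g) t \<noteq> 0"
    using poly_all_0_iff_0 by blast
  then show ?thesis unfolding poly_mult poly_pull f g by auto
qed

lemma generic_conj [intro]:
  assumes "generic I P" "generic I Q" shows "generic I (\<lambda>c. P c \<and> Q c)"
proof -
  obtain F a G b where *: "polyfun I F" "F a \<noteq> 0" "\<forall>c. F c \<noteq> 0 \<longrightarrow> P c"
      "polyfun I G" "G b \<noteq> 0" "\<forall>c. G c \<noteq> 0 \<longrightarrow> Q c"
    using assms unfolding generic_def by blast
  then obtain c where "F c \<noteq> 0" "G c \<noteq> 0" using polyfun_common_nonzero by blast
  then show ?thesis unfolding generic_def using *
    by (intro exI[of _ "\<lambda>c. F c * G c"] exI[of _ c]) auto
qed

lemma generic_ball [intro]: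
  assumes "finite S" "\<And>s. s \<in> S \<Longrightarrow> generic I (P s)"
  shows "generic I (\<lambda>c. \<forall>s\<in>S. P s c)"
  using assms
proof (induction S rule: finite_induct)
  case empty
  show ?case using generic_polyfun[of I "\<lambda>_. 1"] by (auto intro: generic_mono)
next
  case (insert x S)
  then show ?case using generic_conj[of I "P x" "\<lambda>c. \<forall>s\<in>S. P s c"] by simp
qed

section \<open>Elimination of a common root\<close>

text \<open>For a homogeneous linear system with coefficients depending polynomially on \<open>c\<close>, having only the trivial
  solution is an open condition. Fraction-free Gaussian elimination is used in place of determinants, so
  the set \<open>R\<close> of equations may be larger than the set \<open>J\<close> of unknowns.\<close>

lemma trivial_kernel_open:
  fixes v :: "'i \<Rightarrow> ('v \<Rightarrow> 'a::field_char_0) \<Rightarrow> 'j \<Rightarrow> 'a"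
  assumes "finite J" "\<And>i j. i \<in> R \<Longrightarrow> j \<in> J \<Longrightarrow> polyfun I (\<lambda>c. v i c j)"
    and "\<And>x. \<forall>i\<in>R. (\<Sum>j\<in>J. v i c0 j * x j) = 0 \<Longrightarrow> \<forall>j\<in>J. x j = 0"
  shows "\<exists>F. polyfun I F \<and> F c0 \<noteq> 0 \<and>
    (\<forall>c x. F c \<noteq> 0 \<longrightarrow> (\<forall>i\<in>R. (\<Sum>j\<in>J. v i c j * x j) = 0) \<longrightarrow> (\<forall>j\<in>J. x j = 0))"
  using assms
proof (induction J arbitrary: v rule: finite_induct)
  case empty
  show ?case by (intro exI[of _ "\<lambda>_. 1"]) auto
next
  case (insert j0 J)
  have "\<exists>i0\<in>R. v i0 c0 j0 \<noteq> 0"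
  proof (rule ccontr)
    assume "\<not> ?thesis"
    then have "\<forall>i\<in>R. (\<Sum>j\<in>insert j0 J. v i c0 j * (if j = j0 then 1 else 0)) = 0"
      using insert.hyps by (simp add: sum.delta if_distrib[of "(*) _"] cong: if_cong)
    from insert.prems(2)[OF this] show False by simp
  qed
  then obtain i0 where i0: "i0 \<in> R" "v i0 c0 j0 \<noteq> 0" by blast
  \<comment> \<open>The unknown \<open>j0\<close> is eliminated with the pivot in row \<open>i0\<close>, without division.\<close>
  define w where "w i c j = v i0 c j0 * v i c j - v i c j0 * v i0 c j" for i c j
  have sum_w: "(\<Sum>j\<in>J. w i c j * x j) = v i0 c j0 * (\<Sum>j\<in>J. v i c j * x j)
      - v i c j0 * (\<Sum>j\<in>J. v i0 c j * x j)" for i c x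
    unfolding w_def by (simp add: algebra_simps sum_subtractf sum_distrib_left)
  have "\<exists>F. polyfun I F \<and> F c0 \<noteq> 0 \<and>
    (\<forall>c x. F c \<noteq> 0 \<longrightarrow> (\<forall>i\<in>R. (\<Sum>j\<in>J. w i c j * x j) = 0) \<longrightarrow> (\<forall>j\<in>J. x j = 0))"
  proof (rule insert.IH)
    show "polyfun I (\<lambda>c. w i c j)" if "i \<in> R" "j \<in> J" for i j
      unfolding w_def using that i0 by (intro polyfun_diff polyfun_mult insert.prems) auto
    fix x assume x: "\<forall>i\<in>R. (\<Sum>j\<in>J. w i c0 j * x j) = 0"
    define y where "y = x(j0 := - (\<Sum>j\<in>J. v i0 c0 j * x j) / v i0 c0 j0)"
    have y: "(\<Sum>j\<in>J. b j * y j) = (\<Sum>j\<in>J. b j * x j)" for b :: "'j \<Rightarrow> 'a"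
      using insert.hyps unfolding y_def by (intro sum.cong) auto
    have "\<forall>i\<in>R. (\<Sum>j\<in>insert j0 J. v i c0 j * y j) = 0"
    proof
      fix i assume "i \<in> R"
      then have "v i0 c0 j0 * (\<Sum>j\<in>J. v i c0 j * x j) = v i c0 j0 * (\<Sum>j\<in>J. v i0 c0 j * x j)"
        using x sum_w[of i c0 x] by simp
      moreover have "y j0 = - (\<Sum>j\<in>J. v i0 c0 j * x j) / v i0 c0 j0" by (simp add: y_def)
      ultimately show "(\<Sum>j\<in>insert j0 J. v i c0 j * y j) = 0"
        using i0 insert.hyps by (simp add: y) (simp add: field_simps)
    qed
    from insert.prems(2)[OF this] have "\<forall>j\<in>J. y j = 0" by simp
    then show "\<forall>j\<in>J. x j = 0" using insert.hyps unfolding y_def by (metis fun_upd_other)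
  qed
  then obtain F where F: "polyfun I F" "F c0 \<noteq> 0"
    "\<And>c x. F c \<noteq> 0 \<Longrightarrow> \<forall>i\<in>R. (\<Sum>j\<in>J. w i c j * x j) = 0 \<Longrightarrow> \<forall>j\<in>J. x j = 0" by blast
  show ?case
  proof (intro exI[of _ "\<lambda>c. F c * v i0 c j0"] conjI allI impI)
    show "polyfun I (\<lambda>c. F c * v i0 c j0)" using F i0 by (intro polyfun_mult insert.prems) auto
    show "F c0 * v i0 c0 j0 \<noteq> 0" using F i0 by simp
    fix c x assume c: "F c * v i0 c j0 \<noteq> 0"
      and x: "\<forall>i\<in>R. (\<Sum>j\<in>insert j0 J. v i c j * x j) = 0"
    have s: "(\<Sum>j\<in>J. v i c j * x j) = - v i c j0 * x j0" if "i \<in> R" for i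
      using x that insert.hyps by (auto simp: eq_neg_iff_add_eq_0 add.commute)
    have "\<forall>i\<in>R. (\<Sum>j\<in>J. w i c j * x j) = 0" using s i0(1) by (simp add: sum_w)
    then have J: "\<forall>j\<in>J. x j = 0" using F(3) c by auto
    then have "v i0 c j0 * x j0 = 0" using s[OF i0(1)] by simp
    then show "\<forall>j\<in>insert j0 J. x j = 0" using J c by auto
  qed
qed

text \<open>A nonzero element of least degree of the ideal \<open>(p, q)\<close> divides both generators, so it has no root and
  is a constant.\<close>

lemma bezout_no_common_root:
  fixes p q :: "'a::alg_closed_field poly"
  assumes "p \<noteq> 0" "\<nexists>t. poly p t = 0 \<and> poly q t = 0"
  shows "\<exists>a b. a * p + b * q = 1"
proof -
  define J where "J = {a * p + b * q | a b. a * p + b * q \<noteq> 0}"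
  have "1 * p + 0 * q \<in> J" unfolding J_def using assms by (smt (verit) add.right_neutral mem_Collect_eq mult_1 mult_zero_left)
  then have "\<exists>d. d \<in> J \<and> (\<forall>e. e \<in> J \<longrightarrow> degree d \<le> degree e)"
    by (rule ex_has_least_nat[of "\<lambda>d. d \<in> J" _ degree])
  then obtain d where d: "d \<in> J" "\<And>e. e \<in> J \<Longrightarrow> degree d \<le> degree e" by blast
  then obtain a b where ab: "d = a * p + b * q" "d \<noteq> 0" unfolding J_def by blast
  have dvd: "d dvd f" if "f = u * p + v * q" for f u v
  proof (rule ccontr)
    assume "\<not> d dvd f"
    then have nz: "f mod d \<noteq> 0" by (simp add: dvd_eq_mod_eq_0)
    have "f mod d = (u - (f div d) * a) * p + (v - (f div d) * b) * q"
      using that ab(1) by (simp add: minus_div_mult_eq_mod[symmetric] algebra_simps)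
    then have "f mod d \<in> J" using nz unfolding J_def mem_Collect_eq by metis
    then have "degree d \<le> degree (f mod d)" using d by blast
    moreover have "degree (f mod d) < degree d"
      using degree_mod_less'[of d f] ab nz by blast
    ultimately show False by simp
  qed
  have "d dvd p" "d dvd q" using dvd[of p 1 0] dvd[of q 0 1] by simp_all
  then have "\<nexists>t. poly d t = 0" using assms(2) by (metis dvdE mult_zero_left poly_mult)
  then have "degree d = 0" using alg_closed_imp_poly_has_root by blast
  then obtain e where e: "d = [:e:]" "e \<noteq> 0" using ab(2) by (metis degree_eq_zeroE pCons_0_0)
  then have "1 = smult (inverse e) d" by (simp add: one_pCons)
  also have "\<dots> = smult (inverse e) a * p + smult (inverse e) b * q"
    using ab by (simp add: smult_add_right)
  finally show ?thesis by metis
qed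

text \<open>The degrees of the coefficients are bounded by reducing one of them modulo \<open>p\<close>. This is the
  surjectivity of the Sylvester matrix.\<close>

lemma bezout_bounded:
  fixes p q :: "'a::alg_closed_field poly"
  assumes "p \<noteq> 0" "\<nexists>t. poly p t = 0 \<and> poly q t = 0"
    and "degree f < degree p + n" "degree q \<le> n"
  shows "\<exists>a b. f = a * p + b * q \<and> (\<forall>i\<ge>n. coeff a i = 0) \<and> (\<forall>i\<ge>degree p. coeff b i = 0)"
proof -
  obtain a b where ab: "a * p + b * q = 1" using bezout_no_common_root assms by blast
  define r where "r = (f * b) mod p"
  define e where "e = f * a + (f * b) div p * q"
  have f: "f = e * p + r * q"
  proof -
    have "f = f * (a * p + b * q)" using ab by simp
    also have "\<dots> = f * a * p + ((f * b) div p * p + r) * q"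
      unfolding r_def by (simp add: algebra_simps div_mult_mod_eq)
    finally show ?thesis unfolding e_def by (simp add: algebra_simps)
  qed
  have r: "coeff r i = 0" if "i \<ge> degree p" for i
  proof (cases "r = 0")
    case False
    then have "degree r < degree p" unfolding r_def using degree_mod_less'[of p "f * b"] assms by blast
    then show ?thesis using that by (intro coeff_eq_0) simp
  qed simp
  have "coeff e i = 0" if "i \<ge> n" for i
  proof (cases "e = 0")
    case False
    have "degree (r * q) < degree p + n" if "r \<noteq> 0"
      using degree_mult_le[of r q] degree_mod_less'[of p "f * b"] assms that
      unfolding r_def by fastforce
    then have "degree (r * q) < degree p + n" using assms by (cases "r = 0") auto
    then have "degree (f - r * q) < degree p + n" using assms degree_diff_less by blast
    then have "degree (e * p) < degree p + n" using f by simp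
    then have "degree e < n" using False assms by (simp add: degree_mult_eq)
    then show ?thesis using that by (intro coeff_eq_0) simp
  qed simp
  then show ?thesis using f r by blast
qed

text \<open>The rows of the Sylvester system are the coefficient vectors of \<open>t\<^sup>i p\<close> for \<open>i < n\<close> and \<open>t\<^sup>i q\<close> for
  \<open>i < deg p\<close>. At \<open>c0\<close> they span all polynomials of degree below \<open>deg p + n\<close>, so their common kernel is
  trivial there and on an open set; a common root \<open>t\<close> would put \<open>(1, t, t\<^sup>2, \<dots>)\<close> into that kernel.
  The spanning argument reduces modulo \<open>p\<close>, which is why \<open>p\<close> has to attain its degree bound at \<open>c0\<close>.\<close>

lemma elimination:
  fixes p q :: "('v \<Rightarrow> 'a) \<Rightarrow> 'a::{alg_closed_field, field_char_0} poly"
  assumes "\<And>i. polyfun I (\<lambda>c. coeff (p c) i)" "\<And>i. polyfun I (\<lambda>c. coeff (q c) i)"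
    and "\<And>c. degree (p c) \<le> degree (p c0)" "\<And>c. degree (q c) \<le> n"
    and "p c0 \<noteq> 0" "\<nexists>t. poly (p c0) t = 0 \<and> poly (q c0) t = 0"
  shows "\<exists>F. polyfun I F \<and> F c0 \<noteq> 0 \<and>
    (\<forall>c. F c \<noteq> 0 \<longrightarrow> (\<nexists>t. poly (p c) t = 0 \<and> poly (q c) t = 0))"
proof (cases "degree (p c0) + n = 0")
  case True
  have deg: "degree (p c) = 0" for c using assms(3)[of c] True by simp
  have "\<nexists>t. poly (p c) t = 0" if "coeff (p c) 0 \<noteq> 0" for c
    using that degree_eq_zeroE[OF deg[of c]] by fastforce
  moreover have "coeff (p c0) 0 \<noteq> 0" using assms(5) deg[of c0]
    by (metis degree_eq_zeroE coeff_pCons_0 pCons_0_0)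
  ultimately show ?thesis using assms(1)[of 0] by blast
next
  case False
  define m where "m = degree (p c0)"
  define N where "N = m + n"
  define R where "R = Inl ` {..<n} \<union> Inr ` {..<m}"
  define f where "f r c = (case r of Inl i \<Rightarrow> monom 1 i * p c | Inr i \<Rightarrow> monom 1 i * q c)" for r c
  define v where "v r c j = coeff (f r c) j" for r c j
  have "\<exists>F. polyfun I F \<and> F c0 \<noteq> 0 \<and>
    (\<forall>c x. F c \<noteq> 0 \<longrightarrow> (\<forall>i\<in>R. (\<Sum>j\<in>{..<N}. v i c j * x j) = 0) \<longrightarrow> (\<forall>j\<in>{..<N}. x j = 0))"
  proof (rule trivial_kernel_open)
    show "polyfun I (\<lambda>c. v r c j)" for r j
      using assms(1,2) unfolding v_def f_def coeff_monom_mult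
      by (cases "j < projl r"; cases "j < projr r"; cases r) (auto simp: coeff_monom_mult)
    fix x assume x: "\<forall>r\<in>R. (\<Sum>j<N. v r c0 j * x j) = 0"
    have xp: "(\<Sum>j<N. coeff (monom 1 i * p c0) j * x j) = 0" if "i < n" for i
      using bspec[OF x, of "Inl i"] that by (simp add: R_def v_def f_def)
    have xq: "(\<Sum>j<N. coeff (monom 1 i * q c0) j * x j) = 0" if "i < m" for i
      using bspec[OF x, of "Inr i"] that by (simp add: R_def v_def f_def)
    have lin: "(\<Sum>j<N. coeff (a * g) j * x j) = 0"
      if "\<forall>i\<ge>k. coeff a i = 0" "\<forall>i<k. (\<Sum>j<N. coeff (monom 1 i * g) j * x j) = 0" for a g k
    proof -
      have "a = (\<Sum>i<k. smult (coeff a i) (monom 1 i))"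
        using that(1) by (intro poly_eqI)
          (auto simp: coeff_sum if_distrib[of "(*) _"] sum.delta not_less cong: if_cong)
      then have "a * g = (\<Sum>i<k. smult (coeff a i) (monom 1 i * g))"
        by (metis (no_types, lifting) sum_distrib_right sum.cong mult_smult_left)
      then have "(\<Sum>j<N. coeff (a * g) j * x j) =
          (\<Sum>j<N. \<Sum>i<k. coeff a i * (coeff (monom 1 i * g) j * x j))"
        by (simp add: coeff_sum sum_distrib_right mult.assoc)
      also have "\<dots> = (\<Sum>i<k. \<Sum>j<N. coeff a i * (coeff (monom 1 i * g) j * x j))"
        by (rule sum.swap)
      also have "\<dots> = 0" using that(2) by (simp add: sum_distrib_left[symmetric])
      finally show ?thesis .
    qed
    show "\<forall>j\<in>{..<N}. x j = 0"
    proof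
      fix j assume j: "j \<in> {..<N}"
      then obtain a b where ab: "monom 1 j = a * p c0 + b * q c0"
        "\<forall>i\<ge>n. coeff a i = 0" "\<forall>i\<ge>m. coeff b i = 0"
        using bezout_bounded[of "p c0" "q c0" "monom 1 j" n] assms unfolding N_def m_def
        by (auto simp: degree_monom_eq)
      have "x j = (\<Sum>k<N. coeff (monom 1 j) k * x k)"
      proof -
        have "(\<Sum>k<N. coeff (monom 1 j) k * x k) = (\<Sum>k<N. if k = j then x k else 0)"
          by (intro sum.cong) auto
        then show ?thesis using j by simp
      qed
      also have "\<dots> = (\<Sum>k<N. coeff (a * p c0) k * x k) + (\<Sum>k<N. coeff (b * q c0) k * x k)"
        unfolding ab(1) by (simp add: sum.distrib algebra_simps)
      also have "(\<Sum>k<N. coeff (a * p c0) k * x k) = 0"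
        using xp ab(2) by (intro lin[of n]) auto
      also have "(\<Sum>k<N. coeff (b * q c0) k * x k) = 0"
        using xq ab(3) by (intro lin[of m]) auto
      finally show "x j = 0" by simp
    qed
  qed auto
  then obtain F where F: "polyfun I F" "F c0 \<noteq> 0"
    "\<And>c x. F c \<noteq> 0 \<Longrightarrow> \<forall>i\<in>R. (\<Sum>j<N. v i c j * x j) = 0 \<Longrightarrow> \<forall>j\<in>{..<N}. x j = 0" by blast
  have "False" if c: "F c \<noteq> 0" and t: "poly (p c) t = 0" "poly (q c) t = 0" for c t
  proof -
    have "(\<Sum>j<N. v r c j * t ^ j) = 0" if "r \<in> R" for r
    proof -
      have "degree (f r c) < N"
        using that assms(3)[of c] assms(4)[of c]
          degree_mult_le[of "monom 1 (projl r)" "p c"] degree_mult_le[of "monom 1 (projr r)" "q c"]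
        by (auto simp: R_def N_def m_def f_def degree_monom_eq)
      moreover have "poly (f r c) t = 0" using t unfolding f_def by (cases r) auto
      moreover have "poly (f r c) t = (\<Sum>j<N. v r c j * t ^ j)" if "degree (f r c) < N"
        unfolding v_def poly_altdef using that
        by (intro sum.mono_neutral_left) (auto simp: coeff_eq_0)
      ultimately show ?thesis by simp
    qed
    then have "\<forall>j\<in>{..<N}. t ^ j = 0" using F(3)[OF c, of "\<lambda>j. t ^ j"] by blast
    then have "t ^ 0 = 0" using False unfolding N_def m_def by blast
    then show False by simp
  qed
  then show ?thesis using F by blast
qed

section \<open>Closed sets and the image of a polynomial curve\<close>

lemma closedin_zero_set [simp]: "closedin zariski (zero_set S)"
  by (auto simp: closedin_zariski)

lemma zariski_closure: "zariski closure_of X = zero_set (vanishing_ideal X)"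
proof
  show "zariski closure_of X \<subseteq> zero_set (vanishing_ideal X)"
    by (rule closure_of_minimal[OF _ closedin_zero_set]) (auto simp: zero_set_def vanishing_ideal_def)
  have "closedin zariski (zariski closure_of X)" by simp
  then obtain S where S: "zariski closure_of X = zero_set S" unfolding closedin_zariski by blast
  then have "S \<subseteq> vanishing_ideal X"
    using closure_of_subset[of X zariski] by (auto simp: zero_set_def vanishing_ideal_def)
  then show "zero_set (vanishing_ideal X) \<subseteq> zariski closure_of X"
    unfolding S by (auto simp: zero_set_def)
qed

lemma closed_polyfun_separates:
  assumes "closedin zariski V" "x \<notin> V"
  shows "\<exists>f. f \<in> vanishing_ideal V \<and> mpoly_eval f (($) x) \<noteq> 0"
  using assms by (auto simp: closedin_zariski zero_set_def vanishing_ideal_def)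

definition curve_point :: "'k poly ^ 'n \<Rightarrow> 'k \<Rightarrow> 'k::field_char_0 ^ 'n" where
  "curve_point g t = (\<chi> i. poly (g $ i) t)"

lemma curve_point_nth [simp]: "curve_point g t $ i = poly (g $ i) t"
  by (simp add: curve_point_def)

lemma eval_curve_point: "mpoly_eval f (($) (curve_point g t)) = poly (pull (($) g) f) t"
  unfolding poly_pull by (intro arg_cong[of _ _ "mpoly_eval f"]) (simp add: fun_eq_iff)

text \<open>Used to choose coefficients of a linear form that avoids finitely many hyperplanes at once.\<close>

lemma generic_dot:
  fixes v :: "'k::field_char_0 ^ 'n"
  assumes "v \<noteq> 0" shows "generic UNIV (\<lambda>b. (\<Sum>i\<in>UNIV. b i * v $ i) \<noteq> 0)"
proof -
  obtain j where "v $ j \<noteq> 0" using assms by (auto simp: vec_eq_iff)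
  then have "(\<Sum>i\<in>UNIV. (if i = j then 1 else 0) * v $ i) \<noteq> 0"
    by (simp add: if_distrib[of "\<lambda>x. x * _"] sum.delta cong: if_cong)
  then show ?thesis by (intro generic_polyfun[where F = "\<lambda>b. \<Sum>i\<in>UNIV. b i * v $ i"]
        polyfun_sum polyfun_mult polyfun_var polyfun_const UNIV_I)
qed

text \<open>A point \<open>x\<close> outside of the image is separated from it by eliminating \<open>t\<close> from \<open>g\<^sub>i\<^sub>0(t) = y\<^sub>i\<^sub>0\<close> and
  \<open>\<Sum>i. b\<^sub>i (g\<^sub>i(t) - y\<^sub>i) = 0\<close>. These have a common root whenever \<open>y\<close> is in the image. At \<open>y = x\<close> they have
  none if \<open>b\<close> is not orthogonal to any of the finitely many vectors \<open>\<gamma>(t) - x\<close> with \<open>g\<^sub>i\<^sub>0(t) = x\<^sub>i\<^sub>0\<close>.\<close>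

lemma closed_curve_image:
  fixes g :: "'k::{alg_closed_field, field_char_0} poly ^ 'n"
  assumes "degree (g $ i0) > 0"
  shows "closedin zariski (range (curve_point g))"
proof -
  let ?C = "range (curve_point g)"
  have "zariski closure_of ?C \<subseteq> ?C"
  proof
    fix x assume x: "x \<in> zariski closure_of ?C"
    show "x \<in> ?C"
    proof (rule ccontr)
      assume nx: "x \<notin> ?C"
      define p where "p y = g $ i0 - [:y i0:]" for y
      have dp: "degree (p y) = degree (g $ i0)" for y
        using assms unfolding p_def by (subst diff_conv_add_uminus, subst degree_add_eq_left) auto
      define S where "S = {t. poly (p (($) x)) t = 0}"
      have "p (($) x) \<noteq> 0" using dp[of "($) x"] assms by force
      then have fin: "finite S" unfolding S_def by (rule poly_roots_finite)
      have "generic UNIV (\<lambda>b. \<forall>t\<in>S. (\<Sum>i\<in>UNIV. b i * (curve_point g t - x) $ i) \<noteq> 0)"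
        using nx by (intro generic_ball fin generic_dot) auto
      from generic_ex[OF this] obtain b
        where b: "\<forall>t\<in>S. (\<Sum>i\<in>UNIV. b i * (curve_point g t - x) $ i) \<noteq> 0" ..
      define q where "q y = (\<Sum>i\<in>UNIV. smult (b i) (g $ i - [:y i:]))" for y
      have q: "poly (q y) t = (\<Sum>i\<in>UNIV. b i * (poly (g $ i) t - y i))" for y t
        by (simp add: q_def poly_sum)
      have "\<exists>F. polyfun UNIV F \<and> F (($) x) \<noteq> 0 \<and>
        (\<forall>y. F y \<noteq> 0 \<longrightarrow> (\<nexists>t. poly (p y) t = 0 \<and> poly (q y) t = 0))"
      proof (rule elimination)
        show "polyfun UNIV (\<lambda>y. coeff (p y) i)" for i
          by (cases i) (simp_all add: p_def polyfun_intros)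
        show "polyfun UNIV (\<lambda>y. coeff (q y) i)" for i
          by (cases i) (simp_all add: q_def coeff_sum polyfun_intros)
        show "degree (q y) \<le> Max (range (\<lambda>i. degree (g $ i)))" for y
          unfolding q_def
        proof (intro degree_sum_le order.trans[OF degree_smult_le])
          fix i
          have "degree (g $ i) \<le> Max (range (\<lambda>i. degree (g $ i)))" by (intro Max_ge) auto
          then show "degree (g $ i - [:y i:]) \<le> Max (range (\<lambda>i. degree (g $ i)))"
            by (intro degree_diff_le) auto
        qed auto
        show "p (($) x) \<noteq> 0" by fact
        show "\<nexists>t. poly (p (($) x)) t = 0 \<and> poly (q (($) x)) t = 0"
          using b unfolding S_def q by auto
      qed (simp add: dp)
      then obtain f where f: "mpoly_eval f (($) x) \<noteq> 0"
        "\<And>y. mpoly_eval f y \<noteq> 0 \<Longrightarrow> \<nexists>t. poly (p y) t = 0 \<and> poly (q y) t = 0"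
        unfolding polyfun_def by blast
      have "mpoly_eval f (($) (curve_point g t)) = 0" for t
        using f(2)[of "($) (curve_point g t)"] unfolding q p_def by force
      then have "f \<in> vanishing_ideal ?C" by (auto simp: vanishing_ideal_def)
      then show False using x f unfolding zariski_closure zero_set_def by blast
    qed
  qed
  then show ?thesis
    using closure_of_subset[of ?C zariski] closedin_closure_of[of zariski ?C]
    by (metis subset_antisym topspace_zariski subset_UNIV)
qed

section \<open>The coordinate ring and its fraction field\<close>

text \<open>The ring \<open>K[g\<^sub>1, \<dots>, g\<^sub>n]\<close> of regular functions on the curve, as a subring of \<open>K[t]\<close>.\<close>

definition coord_ring :: "'k::field_char_0 poly ^ 'n \<Rightarrow> 'k poly set" where
  "coord_ring g = range (pull (($) g))"

lemma coord_ring_add [intro]: "a \<in> coord_ring g \<Longrightarrow> b \<in> coord_ring g \<Longrightarrow> a + b \<in> coord_ring g"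
  by (auto simp: coord_ring_def simp flip: pull_add)

lemma coord_ring_mult [intro]: "a \<in> coord_ring g \<Longrightarrow> b \<in> coord_ring g \<Longrightarrow> a * b \<in> coord_ring g"
  by (auto simp: coord_ring_def simp flip: pull_mult)

lemma coord_ring_const [intro, simp]: "[:a:] \<in> coord_ring g"
  unfolding coord_ring_def using pull_const[of "($) g" a] by (metis rangeI)

lemma coord_ring_0 [intro, simp]: "0 \<in> coord_ring g"
  using coord_ring_const[of 0 g] by simp

lemma coord_ring_var [intro, simp]: "g $ i \<in> coord_ring g"
  unfolding coord_ring_def using pull_var[of "($) g" i] by (metis rangeI)

lemma coord_ring_smult [intro]: "a \<in> coord_ring g \<Longrightarrow> smult c a \<in> coord_ring g"
  using coord_ring_mult[OF coord_ring_const[of c]] by fastforce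

lemma coord_ring_uminus [intro]: "a \<in> coord_ring g \<Longrightarrow> - a \<in> coord_ring g"
  using coord_ring_smult[of a g "-1"] by simp

lemma coord_ring_diff [intro]: "a \<in> coord_ring g \<Longrightarrow> b \<in> coord_ring g \<Longrightarrow> a - b \<in> coord_ring g"
  using coord_ring_add[OF _ coord_ring_uminus] by fastforce

lemma poly_single_root:
  fixes p :: "'a::alg_closed_field poly"
  assumes "p \<noteq> 0" "\<And>t. poly p t = 0 \<Longrightarrow> t = s"
  shows "p = smult (lead_coeff p) ([:-s, 1:] ^ degree p)"
proof -
  obtain A where A: "size A = degree p" "p = smult (lead_coeff p) (\<Prod>x\<in>#A. [:-x, 1:])"
    using alg_closed_imp_factorization[OF assms(1)] by blast
  have "x = s" if "x \<in># A" for x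
  proof (rule assms(2))
    have "poly (\<Prod>x\<in>#A. [:-x, 1:]) x = 0"
      using that by (auto simp: poly_prod_mset prod_mset_zero_iff)
    then show "poly p x = 0" by (subst A(2)) simp
  qed
  then have "A = replicate_mset (size A) s" by (metis set_mset_subset_singletonD subsetI singletonI)
  then have "(\<Prod>x\<in>#A. [:-x, 1:]) = [:-s, 1:] ^ degree p"
    using A(1) by (metis image_replicate_mset prod_mset_replicate_mset)
  then show ?thesis using A(2) by simp
qed

lemma finite_fibre:
  fixes g :: "'k::field_char_0 poly ^ 'n"
  assumes "degree (g $ i0) > 0" shows "finite {s. curve_point g s = x}"
proof -
  have "g $ i0 - [:x $ i0:] \<noteq> 0" using assms by auto
  then have "finite {s. poly (g $ i0 - [:x $ i0:]) s = 0}" by (rule poly_roots_finite)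
  then show ?thesis by (rule rev_finite_subset) auto
qed

text \<open>\<open>M\<close> is the minimal polynomial of the parameter over the fraction field of the coordinate ring, with
  denominators cleared. It divides \<open>g\<^sub>i(T) - g\<^sub>i\<close> over that field, because \<open>g\<^sub>i(T) - g\<^sub>i\<close> also vanishes at the
  parameter. So, away from the zeros of the leading coefficient, every root \<open>t\<close> of \<open>M\<close> specialized at \<open>s\<close>
  has the same image as \<open>s\<close>.\<close>

lemma minimal_relation:
  fixes g :: "'k::field_char_0 poly ^ 'n"
  assumes i0: "degree (g $ i0) > 0"
  shows "\<exists>M. M \<noteq> 0 \<and> degree M > 0 \<and> (\<forall>i. coeff M i \<in> coord_ring g) \<and>
     (\<forall>s t. poly (lead_coeff M) s \<noteq> 0 \<longrightarrow> poly (poly M [:t:]) s = 0 \<longrightarrow>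
        curve_point g t = curve_point g s)"
proof -
  let ?X = "[:0, 1:] :: 'k poly"
  \<comment> \<open>\<open>E i\<close> is \<open>g\<^sub>i(T) - g\<^sub>i(t)\<close> as a polynomial in \<open>T\<close> over \<open>K[t]\<close>.\<close>
  define E where "E i = map_poly (\<lambda>a. [:a:]) (g $ i) - [:g $ i:]" for i
  have coeff_E: "coeff (E i) k \<in> coord_ring g" for i k
  proof -
    have "coeff (E i) k = [:coeff (g $ i) k:] - (if k = 0 then g $ i else 0)"
      by (cases k) (simp_all add: E_def coeff_map_poly)
    then show ?thesis by auto
  qed
  have poly_E: "poly (E i) q = pcompose (g $ i) q - g $ i" for i q
    by (simp add: E_def pcompose_altdef)
  define S where "S = {M. M \<noteq> 0 \<and> (\<forall>i. coeff M i \<in> coord_ring g) \<and> poly M ?X = 0}"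
  have "coeff (E i0) (degree (g $ i0)) \<noteq> 0"
    using i0 leading_coeff_0_iff[of "g $ i0"]
    by (cases "degree (g $ i0)") (auto simp: E_def coeff_map_poly)
  then have "E i0 \<in> S" unfolding S_def using coeff_E poly_E by auto
  then have "\<exists>M. M \<in> S \<and> (\<forall>N. N \<in> S \<longrightarrow> degree M \<le> degree N)"
    by (rule ex_has_least_nat[of "\<lambda>d. d \<in> S" _ degree])
  then obtain M where M: "M \<in> S" and min: "\<And>N. N \<in> S \<Longrightarrow> degree M \<le> degree N" by blast
  have M0: "M \<noteq> 0" and M1: "\<And>i. coeff M i \<in> coord_ring g" and M2: "poly M ?X = 0"
    using M unfolding S_def by auto
  have deg: "degree M > 0"
  proof (rule ccontr)
    assume "\<not> degree M > 0"
    then obtain a where "M = [:a:]" using degree_eq_zeroE by blast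
    then show False using M0 M2 by simp
  qed
  have red: "poly (poly N [:t:]) s = 0"
    if "\<forall>i. coeff N i \<in> coord_ring g" "poly N ?X = 0" "\<forall>i\<ge>n. coeff N i = 0"
      and lc: "poly (lead_coeff M) s \<noteq> 0" and root: "poly (poly M [:t:]) s = 0" for N s t n
    using that(1-3)
  proof (induction n arbitrary: N)
    case 0
    then have "N = 0" by (intro poly_eqI) auto
    then show ?case by simp
  next
    case (Suc n)
    show ?case
    proof (cases "n < degree M")
      case True
      have "degree N < degree M" using Suc.prems(3) True
        by (metis deg degree_0 leading_coeff_neq_0 not_less_eq_eq not_less order.strict_trans1)
      then have "N = 0" using min[of N] Suc.prems unfolding S_def by fastforce
      then show ?thesis by simp
    next
      case False
      \<comment> \<open>One step of pseudo-division by \<open>M\<close> stays within the coordinate ring.\<close>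
      define N' where "N' = smult (lead_coeff M) N - smult (coeff N n) (monom 1 (n - degree M) * M)"
      have "poly (poly N' [:t:]) s = 0"
      proof (rule Suc.IH)
        show "\<forall>i. coeff N' i \<in> coord_ring g"
        proof
          fix i
          have "coeff (monom 1 (n - degree M) * M) i \<in> coord_ring g"
            using M1 by (simp add: coeff_monom_mult)
          then show "coeff N' i \<in> coord_ring g"
            unfolding N'_def coeff_diff coeff_smult using Suc.prems(1) M1 by blast
        qed
        show "poly N' ?X = 0" using Suc.prems(2) M2 by (simp add: N'_def)
        show "\<forall>i\<ge>n. coeff N' i = 0"
        proof (intro allI impI)
          fix i assume i: "i \<ge> n"
          show "coeff N' i = 0"
          proof (cases "i = n")
            case True
            then show ?thesis using False by (simp add: N'_def coeff_monom_mult)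
          next
            case n: False
            then have "coeff N i = 0" "i - (n - degree M) > degree M"
              using i False Suc.prems(3) by auto
            then show ?thesis by (simp add: N'_def coeff_monom_mult coeff_eq_0)
          qed
        qed
      qed
      then show ?thesis using lc root by (simp add: N'_def)
    qed
  qed
  have "curve_point g t = curve_point g s"
    if "poly (lead_coeff M) s \<noteq> 0" "poly (poly M [:t:]) s = 0" for s t
  proof -
    have "poly (g $ i) t = poly (g $ i) s" for i
    proof -
      have "poly (poly (E i) [:t:]) s = 0"
        by (rule red[where n = "Suc (degree (E i))"])
          (use that coeff_E poly_E in \<open>auto intro: coeff_eq_0\<close>)
      then show ?thesis unfolding poly_E by (simp add: poly_pcompose)
    qed
    then show ?thesis by (simp add: vec_eq_iff)
  qed
  then show ?thesis using M0 M1 deg by blast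
qed

text \<open>By injectivity the minimal polynomial \<open>M\<close>, specialized at almost every \<open>s\<close>, has \<open>s\<close> as its only root, so
  it is a multiple of \<open>(T - s)\<^sup>r\<close>. Its two top coefficients then give \<open>t\<close> as a quotient, since \<open>r \<noteq> 0\<close> in
  characteristic zero.\<close>

lemma parameter_in_fraction_field:
  fixes g :: "'k::{alg_closed_field, field_char_0} poly ^ 'n"
  assumes i0: "degree (g $ i0) > 0" and B: "finite B" and inj: "inj_on (curve_point g) (- B)"
  shows "\<exists>b\<in>coord_ring g. b \<noteq> 0 \<and> [:0, 1:] * b \<in> coord_ring g"
proof -
  obtain M where M: "M \<noteq> 0" "degree M > 0" "\<And>i. coeff M i \<in> coord_ring g"
    "\<And>s t. poly (lead_coeff M) s \<noteq> 0 \<Longrightarrow> poly (poly M [:t:]) s = 0 \<Longrightarrow> curve_point g t = curve_point g s"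
    using minimal_relation[OF i0] by blast
  define r where "r = degree M"
  define Bad where "Bad = B \<union> {s. poly (lead_coeff M) s = 0} \<union>
      (\<Union>b\<in>B. {s. curve_point g s = curve_point g b})"
  have fin: "finite Bad"
    unfolding Bad_def using B M(1) finite_fibre[of g i0] i0 by (auto intro: poly_roots_finite)
  define h where "h = coeff M (r - 1) + smult (of_nat r) ([:0, 1:] * lead_coeff M)"
  have "poly h s = 0" if s: "s \<notin> Bad" for s
  proof -
    define Ms where "Ms = map_poly (\<lambda>q. poly q s) M"
    have coeff_Ms: "coeff Ms i = poly (coeff M i) s" for i
      by (simp add: Ms_def coeff_map_poly)
    have lc: "coeff Ms r \<noteq> 0" using s by (simp add: coeff_Ms Bad_def r_def)
    have "degree Ms \<le> r" unfolding r_def by (intro degree_le) (simp add: coeff_Ms coeff_eq_0)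
    then have deg: "degree Ms = r" using lc le_degree by (intro antisym)
    have eval: "poly Ms t = poly (poly M [:t:]) s" for t
    proof -
      have "poly (poly M [:t:]) s = (\<Sum>i\<le>r. poly (coeff M i) s * t ^ i)"
        unfolding poly_altdef[of M] by (simp add: poly_sum r_def)
      then show ?thesis unfolding poly_altdef[of Ms] deg coeff_Ms by simp
    qed
    have "Ms = smult (lead_coeff Ms) ([:-s, 1:] ^ degree Ms)"
    proof (rule poly_single_root)
      show "Ms \<noteq> 0" using lc by auto
      fix t assume "poly Ms t = 0"
      then have "curve_point g t = curve_point g s" using M(4) s eval by (simp add: Bad_def)
      moreover have "t \<notin> B" using s calculation unfolding Bad_def by force
      moreover have "s \<notin> B" using s unfolding Bad_def by blast
      ultimately show "t = s" using inj by (auto dest: inj_onD)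
    qed
    then have "coeff Ms (r - 1) = coeff Ms r * coeff ([:-s, 1:] ^ r) (r - 1)"
      unfolding deg by (metis coeff_smult)
    also have "coeff ([:-s, 1:] ^ r) (r - 1) = - (of_nat r * s)"
      using M(2) unfolding r_def by (cases "degree M") (auto simp: coeff_linear_poly_power simp del: power_Suc)
    finally show ?thesis unfolding h_def coeff_Ms by (simp add: r_def algebra_simps)
  qed
  then have "- Bad \<subseteq> {s. poly h s = 0}" by blast
  then have "infinite {s. poly h s = 0}"
    using fin by (metis Compl_eq_Diff_UNIV finite_Diff2 infinite_UNIV_char_0 infinite_super)
  then have "h = 0" using poly_roots_finite by blast
  define b where "b = smult (of_nat r) (lead_coeff M)"
  have "[:0, 1:] * b = - coeff M (r - 1)"
    using \<open>h = 0\<close> unfolding h_def b_def mult_smult_right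
    by (metis add.commute eq_neg_iff_add_eq_0)
  then have "[:0, 1:] * b \<in> coord_ring g" using M(3) by auto
  moreover have "b \<in> coord_ring g" "b \<noteq> 0" using M unfolding b_def r_def by auto
  ultimately show ?thesis by blast
qed

section \<open>Smooth points are points of immersion\<close>

definition gradient :: "('n, 'k) mpoly \<Rightarrow> 'k ^ 'n \<Rightarrow> 'k::field ^ 'n" where
  "gradient f p = (\<chi> i. mpoly_eval (partial i f) (($) p))"

lemma gradient_add: "gradient (f + h) p = gradient f p + gradient h p"
  by (simp add: gradient_def vec_eq_iff partial_add mpoly_eval_add)

lemma gradient_mult: "gradient (f * h) p =
    mpoly_eval h (($) p) *s gradient f p + mpoly_eval f (($) p) *s gradient h p"
  by (simp add: gradient_def vec_eq_iff partial_mult mpoly_eval_add mpoly_eval_mult algebra_simps)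

lemma gradient_const [simp]: "gradient (Poly_Mapping.single 0 a) p = 0"
  by (simp add: gradient_def vec_eq_iff partial_single)

lemma gradient_var [simp]:
  "gradient (Poly_Mapping.single (Poly_Mapping.single j (Suc 0)) 1) p = axis j 1"
  by (auto simp add: gradient_def vec_eq_iff partial_single axis_def lookup_single when_def)

lemma tangent_space_gradient:
  "tangent_space V p = {y. \<forall>f\<in>vanishing_ideal V. (\<Sum>i\<in>UNIV. gradient f p $ i * y $ i) = 0}"
  by (simp add: tangent_space_def gradient_def)

lemma vanishing_ideal_add: "f \<in> vanishing_ideal V \<Longrightarrow> h \<in> vanishing_ideal V \<Longrightarrow> f + h \<in> vanishing_ideal V"
  by (simp add: vanishing_ideal_def mpoly_eval_add)

lemma vanishing_ideal_mult: "f \<in> vanishing_ideal V \<Longrightarrow> h * f \<in> vanishing_ideal V"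
  by (simp add: vanishing_ideal_def mpoly_eval_mult)

lemma subspace_tangent_space: "vec.subspace (tangent_space V p)"
  unfolding vec.subspace_def tangent_space_gradient
  by (auto simp: algebra_simps sum.distrib simp flip: sum_distrib_left)

text \<open>The functional is represented by the vector of its values on the coordinate axes.\<close>

lemma separating_functional:
  fixes W :: "('k::field ^ 'n) set"
  assumes "vec.subspace W" "v \<notin> W"
  shows "\<exists>y. (\<forall>w\<in>W. (\<Sum>j\<in>UNIV. w $ j * y $ j) = 0) \<and> (\<Sum>j\<in>UNIV. v $ j * y $ j) \<noteq> 0"
proof -
  obtain B where B: "B \<subseteq> W" "vec.independent B" "W \<subseteq> vec.span B"
    using vec.basis_exists[of W] by metis
  have "vec.span B = W" using B assms(1) vec.span_minimal by blast
  then have nin: "v \<notin> vec.span B" using assms(2) by simp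
  then have "vec.independent (insert v B)" using B(2) by (simp add: vec.independent_insertI)
  from vec.linear_independent_extend[OF this, of "\<lambda>x. if x = v then 1 else 0"]
  obtain F where F: "Vector_Spaces.linear (*s) (*s) F"
    "\<forall>x\<in>insert v B. F x = (if x = v then (1 :: 'k ^ 'n) else 0)"
    by blast
  have Fv: "F v = 1" using F(2) by simp
  have FB: "F w = 0" if "w \<in> B" for w
    using F(2) that nin vec.span_base[of w B] by auto
  have FW: "F w = 0" if "w \<in> W" for w
    using vec.linear_eq_0_on_span[OF F(1), of B w] FB that B(3) by blast
  obtain i0 :: 'n where True by blast
  define y where "y = (\<chi> j. matrix F $ i0 $ j)"
  have "(\<Sum>j\<in>UNIV. w $ j * y $ j) = F w $ i0" for w
    by (subst matrix_works[OF F(1), symmetric])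
      (simp add: matrix_vector_mult_def y_def mult.commute)
  then show ?thesis using FW Fv by (intro exI[of _ y]) auto
qed

text \<open>The gradients of the vanishing ideal form a linear subspace, with the tangent space as annihilator; a
  subspace of a finite-dimensional space is its own double annihilator.\<close>

lemma gradients_double_annihilator:
  fixes V :: "('k::field ^ 'n) set"
  assumes "p \<in> V" "\<And>y. y \<in> tangent_space V p \<Longrightarrow> (\<Sum>i\<in>UNIV. v $ i * y $ i) = 0"
  shows "\<exists>h\<in>vanishing_ideal V. gradient h p = v"
proof -
  let ?W = "(\<lambda>h. gradient h p) ` vanishing_ideal V"
  have "vec.subspace ?W"
    unfolding vec.subspace_def
  proof (intro conjI ballI allI)
    have "gradient 0 p = 0" "0 \<in> vanishing_ideal V"
      by (auto simp: gradient_def vec_eq_iff vanishing_ideal_def)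
    then show "0 \<in> ?W" by (metis rev_image_eqI)
  next
    fix x y assume "x \<in> ?W" "y \<in> ?W"
    then obtain f h where "x = gradient f p" "f \<in> vanishing_ideal V" "y = gradient h p" "h \<in> vanishing_ideal V"
      by blast
    then show "x + y \<in> ?W" using vanishing_ideal_add[of f V h] gradient_add[of f h p] by (metis image_eqI)
  next
    fix c x assume "x \<in> ?W"
    then obtain f where f: "x = gradient f p" "f \<in> vanishing_ideal V" by blast
    let ?f = "Poly_Mapping.single 0 c * f"
    have "gradient ?f p = c *s x" unfolding gradient_mult f(1) by simp
    moreover have "?f \<in> vanishing_ideal V" using f(2) by (rule vanishing_ideal_mult)
    ultimately show "c *s x \<in> ?W" by (metis image_eqI)
  qed
  then have "v \<in> ?W"
    using separating_functional[of ?W v] assms(2) unfolding tangent_space_gradient by blast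
  then show ?thesis by blast
qed

text \<open>Taylor's formula modulo the square of the maximal ideal of the point with parameter \<open>t0\<close>. The
  predicate \<open>R\<close> stands for membership in any linear subspace that contains this square.\<close>

lemma taylor_mod_squares:
  fixes g :: "'k::field_char_0 poly ^ 'n" and t0 :: 'k
  defines "p \<equiv> curve_point g t0"
  assumes R0: "R 0" and Radd: "\<And>a b. R a \<Longrightarrow> R b \<Longrightarrow> R (a + b)"
    and Rsmult: "\<And>c a. R a \<Longrightarrow> R (smult c a)"
    and Rmult: "\<And>a b. a \<in> coord_ring g \<Longrightarrow> b \<in> coord_ring g \<Longrightarrow> poly a t0 = 0 \<Longrightarrow> poly b t0 = 0 \<Longrightarrow> R (a * b)"
  shows "R (pull (($) g) f - [:mpoly_eval f (($) p):]
    - (\<Sum>i\<in>UNIV. smult (gradient f p $ i) (g $ i - [:p $ i:])))"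
proof -
  define l where "l v = (\<Sum>i\<in>UNIV. smult (v $ i) (g $ i - [:p $ i:]))" for v :: "'k ^ 'n"
  have l_add: "l (v + w) = l v + l w" for v w
    by (simp add: l_def smult_add_left sum.distrib)
  have l_smult: "l (c *s v) = smult c (l v)" for v c
    by (rule poly_eqI) (simp add: l_def coeff_sum sum_distrib_left mult.assoc)
  have l_zero: "l 0 = 0" by (simp add: l_def)
  have l_axis: "l (axis j 1) = g $ j - [:p $ j:]" for j
  proof -
    have "l (axis j 1) = (\<Sum>i\<in>UNIV. if i = j then g $ i - [:p $ i:] else 0)"
      unfolding l_def by (intro sum.cong) (auto simp: axis_def)
    then show ?thesis by simp
  qed
  have "R (pull (($) g) f - [:mpoly_eval f (($) p):] - l (gradient f p))"
  proof (induction f rule: mpoly_ring_induct)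
    case (const a)
    show ?case using R0 l_zero by simp
  next
    case (var i)
    show ?case using R0 l_axis[of i] by simp
  next
    case (add f h)
    have "[:mpoly_eval f (($) p) + mpoly_eval h (($) p):] =
        [:mpoly_eval f (($) p):] + [:mpoly_eval h (($) p):]" by simp
    then show ?case using Radd[OF add]
      by (simp only: pull_add mpoly_eval_add gradient_add l_add) (simp only: algebra_simps)
  next
    case (mult f h)
    let ?f = "pull (($) g) f" and ?h = "pull (($) g) h"
    let ?a = "mpoly_eval f (($) p)" and ?b = "mpoly_eval h (($) p)"
    have "?f \<in> coord_ring g" "?h \<in> coord_ring g" by (simp_all add: coord_ring_def)
    then have "R ((?f - [:?a:]) * (?h - [:?b:]))"
      by (intro Rmult coord_ring_diff coord_ring_const) (simp_all add: eval_curve_point p_def)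
    from Radd[OF this Radd[OF Rsmult[OF mult(1), of ?b] Rsmult[OF mult(2), of ?a]]]
    show ?case
      by (rule back_subst[where P = R])
        (simp add: pull_mult mpoly_eval_mult gradient_mult l_add l_smult
          poly_eq_poly_eq_iff[symmetric] fun_eq_iff algebra_simps)
  qed
  then show ?thesis unfolding l_def .
qed

text \<open>Write \<open>h = X\<^sup>j h\<^sub>1\<close> with \<open>h\<^sub>1(0) \<noteq> 0\<close>; then \<open>h(u) = u\<^sup>j h\<^sub>1(u)\<close>, and the second factor does not vanish
  at \<open>t0\<close>.\<close>

lemma order_pcompose:
  fixes h u :: "'k::field_char_0 poly"
  assumes "poly u t0 = 0" "u \<noteq> 0" "pcompose h u \<noteq> 0"
  shows "order t0 u dvd order t0 (pcompose h u)"
proof -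
  have "h \<noteq> 0" using assms(3) by auto
  then obtain h1 where h: "h = [:-0, 1:] ^ order 0 h * h1" "\<not> [:-0, 1:] dvd h1"
    using order_decomp by blast
  define j where "j = order 0 h"
  have eq: "pcompose h u = u ^ j * pcompose h1 u"
    by (subst h(1)) (simp add: poly_eq_poly_eq_iff[symmetric] fun_eq_iff poly_pcompose j_def)
  have "poly h1 0 \<noteq> 0" using h(2) by (simp add: poly_eq_0_iff_dvd)
  then have "poly (pcompose h1 u) t0 \<noteq> 0" using assms(1) by (simp add: poly_pcompose)
  then have "order t0 (pcompose h1 u) = 0" by (rule order_0I)
  moreover have "order t0 (u ^ j) = j * order t0 u"
    using assms(2) by (induction j) (auto simp: order_mult)
  ultimately show ?thesis unfolding eq using assms(3) eq by (subst order_mult) auto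
qed

lemma order_eq_of_close:
  fixes a w :: "'k::field_char_0 poly"
  assumes "a \<noteq> 0" "[:-t0, 1:] ^ k dvd a - w" "order t0 a < k"
  shows "w \<noteq> 0 \<and> order t0 w = order t0 a"
proof -
  have w: "[:-t0, 1:] ^ n dvd w \<longleftrightarrow> [:-t0, 1:] ^ n dvd a" if "n \<le> k" for n
  proof -
    have "[:-t0, 1:] ^ n dvd a - w" using le_imp_power_dvd[OF that] assms(2) by (rule dvd_trans)
    then show ?thesis using dvd_diff_commute[of _ a w] by (metis diff_add_cancel dvd_add_right_iff)
  qed
  have "w \<noteq> 0" using w[of k] assms by (auto simp: order_divides)
  moreover have "n \<le> order t0 w \<longleftrightarrow> n \<le> order t0 a" if "n \<le> k" for n
    using w[OF that] assms(1) \<open>w \<noteq> 0\<close> by (simp add: order_divides)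
  ultimately show ?thesis using assms(3)
    by (metis Suc_leI Suc_n_not_le_n le_antisym le_refl nat_le_linear order.strict_implies_order not_less_eq_eq)
qed

text \<open>Choose a coordinate \<open>i\<close> in which the tangent line at \<open>p\<close> is not constant, and let \<open>u\<close> be \<open>g\<^sub>i\<close> minus its
  value at \<open>t0\<close>. Every function on the curve that vanishes at \<open>p\<close> is a multiple of \<open>u\<close> up to the square of
  the maximal ideal, so by iteration it is a polynomial in \<open>u\<close> up to any order. Therefore all orders of
  vanishing at \<open>t0\<close> are multiples of the order of \<open>u\<close>, but \<open>b\<close> and \<open>(t - t0) b\<close> have consecutive orders.\<close>

lemma immersion_at_smooth_point:
  fixes g :: "'k::{alg_closed_field, field_char_0} poly ^ 'n"
  defines "C \<equiv> range (curve_point g)"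
  assumes i0: "degree (g $ i0) > 0" and B: "finite B" and inj: "inj_on (curve_point g) (- B)"
    and dim1: "vec.dim (tangent_space C (curve_point g t0)) = 1"
  shows "\<exists>i. poly (pderiv (g $ i)) t0 \<noteq> 0"
proof -
  define p where "p = curve_point g t0"
  define T where "T = tangent_space C p"
  have pC: "p \<in> C" by (simp add: p_def C_def)
  have "\<not> T \<subseteq> {0}"
  proof
    assume "T \<subseteq> {0}"
    then have "vec.dim T = 0" by (simp add: vec.dim_eq_0)
    then show False using dim1 by (simp add: T_def p_def)
  qed
  then obtain y where y: "y \<in> T" "y \<noteq> 0" by blast
  have T: "\<exists>s. z = s *s y" if "z \<in> T" for z
  proof -
    have "vec.dim T \<le> card {y}" using dim1 by (simp add: T_def p_def)
    then have "T \<subseteq> vec.span {y}"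
      using y by (intro vec.card_ge_dim_independent) (auto simp: vec.independent_insert)
    then show ?thesis using that by (auto simp: vec.span_singleton)
  qed
  obtain i where i: "y $ i \<noteq> 0" using y(2) by (auto simp: vec_eq_iff)
  define u where "u = g $ i - [:p $ i:]"
  define x where "x = [:- t0, 1:]"
  have u0: "poly u t0 = 0" by (simp add: u_def p_def)
  have x_dvd: "x dvd q" if "poly q t0 = 0" for q
    using that by (simp add: x_def poly_eq_0_iff_dvd)
  have approx: "\<exists>h. x ^ Suc k dvd f - pcompose h u" if "f \<in> coord_ring g" for f k
    using that
  proof (induction k arbitrary: f)
    case 0
    have "x dvd f - pcompose [:poly f t0:] u" by (intro x_dvd) simp
    then show ?case by (metis power_one_right One_nat_def)
  next
    case (Suc k)
    define R where "R q \<longleftrightarrow> (\<exists>h. x ^ Suc (Suc k) dvd q - pcompose h u)" for q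
    have Radd: "R (a + b)" if "R a" "R b" for a b
    proof -
      obtain h h' where "x ^ Suc (Suc k) dvd a - pcompose h u" "x ^ Suc (Suc k) dvd b - pcompose h' u"
        using \<open>R a\<close> \<open>R b\<close> unfolding R_def by blast
      from dvd_add[OF this] have "x ^ Suc (Suc k) dvd a + b - pcompose (h + h') u"
        by (simp add: pcompose_add algebra_simps)
      then show ?thesis unfolding R_def by blast
    qed
    have Rsmult: "R (smult c a)" if "R a" for c a
    proof -
      obtain h where "x ^ Suc (Suc k) dvd a - pcompose h u"
        using \<open>R a\<close> unfolding R_def by blast
      from dvd_smult[OF this, of c] have "x ^ Suc (Suc k) dvd smult c a - pcompose (smult c h) u"
        by (simp add: pcompose_smult smult_diff_right)
      then show ?thesis unfolding R_def by blast
    qed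
    have Rpoly: "R (pcompose h u)" for h
      unfolding R_def by (intro exI[of _ h]) simp
    have Rmult: "R (a * b)"
      if "a \<in> coord_ring g" "b \<in> coord_ring g" and a0: "poly a t0 = 0" and "poly b t0 = 0" for a b
    proof -
      from Suc.IH[OF that(1)] Suc.IH[OF that(2)] obtain h h'
        where h: "x ^ Suc k dvd a - pcompose h u" "x ^ Suc k dvd b - pcompose h' u"
        by blast
      have "poly (b - pcompose h' u) t0 = 0"
        using h(2) by (metis x_def dvd_power_same dvd_trans dvd_triv_left poly_eq_0_iff_dvd power_Suc)
      then have "x dvd pcompose h' u" using that by (intro x_dvd) simp
      then have "x ^ Suc (Suc k) dvd (a - pcompose h u) * pcompose h' u"
        using mult_dvd_mono[OF h(1)] by (simp add: mult.commute)
      moreover have "x ^ Suc (Suc k) dvd a * (b - pcompose h' u)"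
        using mult_dvd_mono[OF x_dvd[OF a0] h(2)] by simp
      ultimately have "x ^ Suc (Suc k) dvd a * (b - pcompose h' u) + (a - pcompose h u) * pcompose h' u"
        by (rule dvd_add[rotated])
      then have "x ^ Suc (Suc k) dvd a * b - pcompose (h * h') u"
        by (simp add: pcompose_mult algebra_simps)
      then show ?thesis unfolding R_def by blast
    qed
    obtain F where F: "f = pull (($) g) F" using Suc.prems unfolding coord_ring_def by blast
    define c where "c = (\<Sum>j\<in>UNIV. gradient F p $ j * y $ j) / y $ i"
    have "\<exists>h\<in>vanishing_ideal C. gradient h p = gradient F p - c *s axis i 1"
    proof (rule gradients_double_annihilator[OF pC])
      fix z assume "z \<in> tangent_space C p"
      then obtain s where s: "z = s *s y" using T unfolding T_def by blast
      have "(\<Sum>j\<in>UNIV. (gradient F p - c *s axis i 1) $ j * z $ j) =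
          s * ((\<Sum>j\<in>UNIV. gradient F p $ j * y $ j) - (\<Sum>j\<in>UNIV. if j = i then c * y $ j else 0))"
        unfolding s sum_subtractf[symmetric] sum_distrib_left
        by (intro sum.cong) (auto simp: axis_def algebra_simps)
      also have "\<dots> = 0" using i by (simp add: c_def)
      finally show "(\<Sum>j\<in>UNIV. (gradient F p - c *s axis i 1) $ j * z $ j) = 0" .
    qed
    then obtain h where h: "h \<in> vanishing_ideal C" "gradient h p = gradient F p - c *s axis i 1"
      by blast
    \<comment> \<open>\<open>F - h\<close> agrees with \<open>F\<close> on the curve, and its gradient is a multiple of that of coordinate \<open>i\<close>.\<close>
    define G where "G = F + Poly_Mapping.single 0 (-1) * h"
    have "mpoly_eval h (($) (curve_point g t)) = 0" for t
      using h(1) by (simp add: vanishing_ideal_def C_def)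
    then have "pull (($) g) h = 0" by (simp add: pull_eq_0_iff eval_curve_point poly_pull)
    then have pG: "pull (($) g) G = f" by (simp add: G_def pull_add pull_mult F)
    have gG: "gradient G p = c *s axis i 1"
      unfolding G_def gradient_add gradient_mult h(2) by (simp add: algebra_simps)
    have "R (f - [:mpoly_eval G (($) p):] - (\<Sum>j\<in>UNIV. smult (gradient G p $ j) (g $ j - [:p $ j:])))"
      unfolding pG[symmetric] p_def
      by (rule taylor_mod_squares[OF _ Radd Rsmult Rmult]) (use Rpoly[of 0] in simp_all)
    moreover have "(\<Sum>j\<in>UNIV. smult (gradient G p $ j) (g $ j - [:p $ j:])) = smult c u"
    proof -
      have "(\<Sum>j\<in>UNIV. smult (gradient G p $ j) (g $ j - [:p $ j:])) =
        (\<Sum>j\<in>UNIV. if j = i then smult c u else 0)"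
        unfolding gG by (intro sum.cong) (auto simp: axis_def u_def)
      then show ?thesis by simp
    qed
    moreover have "pcompose [:mpoly_eval G (($) p), c:] u = [:mpoly_eval G (($) p):] + smult c u"
      by (simp add: pcompose_pCons)
    ultimately have "R f"
      using Radd[OF _ Rpoly[of "[:mpoly_eval G (($) p), c:]"]] by fastforce
    then show ?case unfolding R_def .
  qed
  obtain b where b: "b \<in> coord_ring g" "b \<noteq> 0" "[:0, 1:] * b \<in> coord_ring g"
    using parameter_in_fraction_field[OF i0 B inj] by blast
  have "x * b = [:0, 1:] * b + smult (- t0) b"
    by (simp add: x_def poly_eq_poly_eq_iff[symmetric] fun_eq_iff algebra_simps)
  then have xb: "x * b \<in> coord_ring g" using b by auto
  have xb0: "x * b \<noteq> 0" using b(2) by (simp add: x_def del: mult_pCons_left)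
  define N where "N = order t0 b"
  have N: "order t0 (x * b) = Suc N"
    using xb0 order_power_n_n[of t0 1] by (subst order_mult) (auto simp: x_def N_def)
  \<comment> \<open>The exponent exceeds the orders of both \<open>b\<close> and \<open>x * b\<close>, so the approximations have the same orders.\<close>
  obtain h1 where h1: "x ^ Suc (Suc N) dvd b - pcompose h1 u" using approx[OF b(1)] by blast
  obtain h2 where h2: "x ^ Suc (Suc N) dvd x * b - pcompose h2 u" using approx[OF xb] by blast
  have 1: "pcompose h1 u \<noteq> 0" "order t0 (pcompose h1 u) = N"
    using order_eq_of_close[OF b(2) h1[unfolded x_def]] unfolding N_def by auto
  have 2: "pcompose h2 u \<noteq> 0" "order t0 (pcompose h2 u) = Suc N"
    using order_eq_of_close[OF xb0[unfolded x_def] h2[unfolded x_def]] N unfolding x_def by auto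
  have "u \<noteq> 0"
  proof
    assume "u = 0"
    then have "pcompose h2 u = [:coeff h2 0:]" by (simp add: pcompose_0')
    then have "order t0 (pcompose h2 u) = 0" using 2(1) by (intro order_0I) auto
    then show False using 2 by simp
  qed
  then have "order t0 u dvd N" "order t0 u dvd Suc N"
    using order_pcompose[OF u0] 1 2 by metis+
  then have "order t0 u = 1" by (metis One_nat_def dvd_1_iff_1 dvd_add_right_iff plus_1_eq_Suc add.commute)
  then have "order t0 (pderiv u) = 0" using order_pderiv[OF \<open>u \<noteq> 0\<close> u0] by simp
  moreover have "pderiv u \<noteq> 0"
    using pderiv_iszero[of u] \<open>u \<noteq> 0\<close> u0 by auto
  ultimately have "poly (pderiv u) t0 \<noteq> 0" by (simp add: order_root)
  then show ?thesis unfolding u_def by (intro exI[of _ i]) (simp add: pderiv_diff)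
qed

section \<open>Irreducible sets\<close>

lemma closedin_polyfuns:
  assumes "\<And>F. F \<in> S \<Longrightarrow> polyfun UNIV F"
  shows "closedin zariski {x. \<forall>F\<in>S. F (($) x) = 0}"
proof -
  have "{x. \<forall>F\<in>S. F (($) x) = 0} = zero_set {f. mpoly_eval f \<in> S}"
    using assms by (fastforce simp: zero_set_def polyfun_def)
  then show ?thesis by simp
qed

lemma irreducible_prime:
  assumes "irreducible_variety Z" "polyfun UNIV F" "polyfun UNIV G" "\<And>x. x \<in> Z \<Longrightarrow> F (($) x) * G (($) x) = 0"
  shows "(\<forall>x\<in>Z. F (($) x) = 0) \<or> (\<forall>x\<in>Z. G (($) x) = 0)"
proof -
  have cl: "closedin zariski (Z \<inter> {x. F (($) x) = 0})" if "polyfun UNIV F" for F :: "('b \<Rightarrow> 'a) \<Rightarrow> 'a"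
    using assms(1) closedin_polyfuns[of "{F}"] that unfolding irreducible_variety_def
    by (intro closedin_Int) auto
  have "Z = Z \<inter> {x. F (($) x) = 0} \<union> Z \<inter> {x. G (($) x) = 0}" using assms(4) by auto
  then have "Z = Z \<inter> {x. F (($) x) = 0} \<or> Z = Z \<inter> {x. G (($) x) = 0}"
    using assms(1) cl[OF assms(2)] cl[OF assms(3)] unfolding irreducible_variety_def by blast
  then show ?thesis by blast
qed

text \<open>Two polynomials that do not vanish identically on the space of parameters have a common point where neither
  vanishes.\<close>

lemma irreducible_image:
  fixes \<Phi> :: "('v \<Rightarrow> 'k::field_char_0) \<Rightarrow> 'k ^ 'n"
  assumes "\<And>i. polyfun UNIV (\<lambda>c. \<Phi> c $ i)" "closedin zariski (range \<Phi>)"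
  shows "irreducible_variety (range \<Phi>)"
  unfolding irreducible_variety_def
proof (intro conjI allI impI)
  fix A B assume *: "closedin zariski A \<and> closedin zariski B \<and> range \<Phi> = A \<union> B"
  show "range \<Phi> = A \<or> range \<Phi> = B"
  proof (rule ccontr)
    assume "\<not> ?thesis"
    then obtain a b where ab: "\<Phi> a \<notin> A" "\<Phi> b \<notin> B" using * by blast
    obtain f where f: "f \<in> vanishing_ideal A" "mpoly_eval f (($) (\<Phi> a)) \<noteq> 0"
      using closed_polyfun_separates ab * by blast
    obtain h where h: "h \<in> vanishing_ideal B" "mpoly_eval h (($) (\<Phi> b)) \<noteq> 0"
      using closed_polyfun_separates ab * by blast
    have pf: "polyfun UNIV (\<lambda>c. mpoly_eval f (($) (\<Phi> c)))" for f
      using assms(1) by (rule polyfun_subst)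
    obtain c where "mpoly_eval f (($) (\<Phi> c)) \<noteq> 0" "mpoly_eval h (($) (\<Phi> c)) \<noteq> 0"
      using polyfun_common_nonzero[OF pf[of f] pf[of h], of a b] f(2) h(2) by auto
    moreover have "\<Phi> c \<in> A \<or> \<Phi> c \<in> B" using * by blast
    ultimately show False using f h by (auto simp: vanishing_ideal_def)
  qed
qed (use assms in auto)

lemma polyfun_poly [intro]: "polyfun I F \<Longrightarrow> polyfun I (\<lambda>c. poly p (F c))"
  by (induction p) auto

lemma closedin_point: "closedin zariski {p :: 'k::field ^ 'n}"
proof -
  have "{p} = {x. \<forall>F\<in>range (\<lambda>i (c :: 'n \<Rightarrow> 'k). c i - p $ i). F (($) x) = 0}"
    by (auto simp: vec_eq_iff)
  also have "closedin zariski \<dots>" by (rule closedin_polyfuns) (auto intro!: polyfun_intros)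
  finally show ?thesis .
qed

lemma irreducible_point: "irreducible_variety {p :: 'k::field ^ 'n}"
  unfolding irreducible_variety_def using closedin_point[of p] by blast

section \<open>Dimension\<close>

definition irreducible_chain :: "nat \<Rightarrow> (nat \<Rightarrow> ('k::field ^ 'n) set) \<Rightarrow> ('k ^ 'n) set \<Rightarrow> bool" where
  "irreducible_chain k Z V \<longleftrightarrow>
     (\<forall>i\<le>k. irreducible_variety (Z i) \<and> Z i \<subseteq> V) \<and> (\<forall>i<k. Z i \<subset> Z (Suc i))"

lemma dimension_eq_Sup: "dimension V = Sup {enat k | k. \<exists>Z. irreducible_chain k Z V}"
  unfolding dimension_def irreducible_chain_def ..

lemma dimension_le:
  assumes "\<And>k Z. irreducible_chain k Z V \<Longrightarrow> k \<le> d" shows "dimension V \<le> enat d"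
  unfolding dimension_eq_Sup using assms by (intro Sup_least) auto

lemma dimension_ge: "irreducible_chain k Z V \<Longrightarrow> enat k \<le> dimension V"
  unfolding dimension_eq_Sup by (intro Sup_upper) blast

lemma dimension_mono: "V \<subseteq> W \<Longrightarrow> dimension V \<le> dimension W"
  unfolding dimension_eq_Sup irreducible_chain_def by (intro Sup_subset_mono) blast

lemma local_dimension_irreducible:
  assumes "irreducible_variety V" "p \<in> V" shows "local_dimension V p = dimension V"
  unfolding local_dimension_def
proof (rule antisym)
  show "(SUP Z\<in>{Z. irreducible_variety Z \<and> Z \<subseteq> V \<and> p \<in> Z}. dimension Z) \<le> dimension V"
    by (intro SUP_least dimension_mono) blast
  show "dimension V \<le> (SUP Z\<in>{Z. irreducible_variety Z \<and> Z \<subseteq> V \<and> p \<in> Z}. dimension Z)"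
    using assms by (intro SUP_upper) blast
qed

text \<open>This excludes that a parametrization of a curve is constant.\<close>

lemma dimension_point: "dimension {p :: 'k::field ^ 'n} \<le> 0"
  unfolding zero_enat_def
proof (rule dimension_le, rule ccontr)
  fix k Z assume Z: "irreducible_chain k Z {p}" and "\<not> k \<le> 0"
  then have "irreducible_variety (Z 0)" "Z 0 \<subset> Z (Suc 0)" "Z (Suc 0) \<subseteq> {p}"
    unfolding irreducible_chain_def by (auto simp: Suc_le_eq)
  then show False unfolding irreducible_variety_def by blast
qed

text \<open>Let \<open>val\<close> extend \<open>ev\<close> from \<open>R\<close> to \<open>R[X]\<close> by sending \<open>X\<close> to a function \<open>F\<close> that vanishes on \<open>Z'\<close> but
  not on \<open>Z\<close>. In a relation \<open>P(F) = 0\<close> on \<open>Z\<close> powers of \<open>X\<close> can be cancelled, because \<open>Z\<close> is irreducible;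
  then the constant term is nonzero and gives a relation on \<open>Z'\<close> with one indeterminate less.\<close>

lemma chain_independence_step:
  fixes ev :: "('n::finite \<Rightarrow> 'k::field_char_0) \<Rightarrow> 'r::comm_ring_1 \<Rightarrow> 'k"
    and val :: "('n \<Rightarrow> 'k) \<Rightarrow> 'r poly \<Rightarrow> 'k"
  assumes Z: "irreducible_variety Z" "Z' \<subseteq> Z"
    and F: "polyfun UNIV F" "\<And>x. x \<in> Z' \<Longrightarrow> F (($) x) = 0" "x0 \<in> Z" "F (($) x0) \<noteq> 0"
    and ev: "\<And>r. polyfun UNIV (\<lambda>c. ev c r)"
    and val: "\<And>c. val c 0 = 0" "\<And>c a P. val c (pCons a P) = ev c a + F c * val c P"
    and P: "P \<noteq> 0" "\<And>x. x \<in> Z \<Longrightarrow> val (($) x) P = 0"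
  shows "\<exists>r. r \<noteq> 0 \<and> (\<forall>x\<in>Z'. ev (($) x) r = 0)"
  using P
proof (induction P rule: pCons_induct)
  case (pCons a P)
  show ?case
  proof (cases "a = 0")
    case True
    have ev0: "ev c 0 = 0" for c using val(2)[of c 0 0] val(1)[of c] by simp
    have "polyfun UNIV (\<lambda>c. val c P)"
      by (induction P rule: pCons_induct) (auto simp: val intro!: polyfun_intros F(1) ev)
    moreover have "F (($) x) * val (($) x) P = 0" if "x \<in> Z" for x
      using pCons.prems(2)[OF that] by (simp add: val True ev0)
    ultimately have "\<forall>x\<in>Z. val (($) x) P = 0"
      using irreducible_prime[OF Z(1) F(1)] F(3,4) by blast
    moreover have "P \<noteq> 0" using True pCons.hyps by simp
    ultimately show ?thesis by (intro pCons.IH) auto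
  next
    case False
    have "ev (($) x) a = 0" if "x \<in> Z'" for x
      using pCons.prems(2)[of x] that Z(2) F(2)[OF that] by (auto simp: val)
    then show ?thesis using False by blast
  qed
qed simp

text \<open>Take \<open>F\<^sub>i\<close> vanishing on \<open>Z (i - 1)\<close> but not on \<open>Z i\<close>. A polynomial relation between them on \<open>Z 3\<close> would
  descend to a nonzero constant that vanishes on the nonempty set \<open>Z 0\<close>.\<close>

lemma chain_algebraically_independent:
  fixes Z :: "nat \<Rightarrow> ('k::field_char_0 ^ 'n) set"
  assumes "irreducible_chain 3 Z V"
  shows "\<exists>F1 F2 F3. polyfun UNIV F1 \<and> polyfun UNIV F2 \<and> polyfun UNIV F3 \<and>
    (\<forall>P. P \<noteq> 0 \<longrightarrow> (\<exists>x\<in>V. poly (poly (poly P [:[:F3 (($) x):]:]) [:F2 (($) x):]) (F1 (($) x)) \<noteq> 0))"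
proof -
  have irr: "irreducible_variety (Z i)" "Z i \<subseteq> V" if "i \<le> 3" for i
    using assms that unfolding irreducible_chain_def by auto
  have sub: "Z i \<subset> Z (Suc i)" if "i < 3" for i
    using assms that unfolding irreducible_chain_def by auto
  have "\<exists>F x. polyfun UNIV F \<and> (\<forall>x\<in>Z i. F (($) x) = 0) \<and> x \<in> Z (Suc i) \<and> F (($) x) \<noteq> 0"
    if i: "i < 3" for i
  proof -
    obtain x where x: "x \<in> Z (Suc i)" "x \<notin> Z i" using sub[OF i] by blast
    have "closedin zariski (Z i)" using irr[of i] i unfolding irreducible_variety_def by simp
    from closed_polyfun_separates[OF this x(2)] obtain f where
      "f \<in> vanishing_ideal (Z i)" "mpoly_eval f (($) x) \<noteq> 0" by blast
    then show ?thesis using x unfolding vanishing_ideal_def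
      by (intro exI[of _ "mpoly_eval f"] exI[of _ x]) auto
  qed
  note ex = this
  obtain F1 x1 where F1: "polyfun UNIV F1" "\<And>x. x \<in> Z 0 \<Longrightarrow> F1 (($) x) = 0" "x1 \<in> Z 1" "F1 (($) x1) \<noteq> 0"
    using ex[of 0] by auto
  obtain F2 x2 where F2: "polyfun UNIV F2" "\<And>x. x \<in> Z 1 \<Longrightarrow> F2 (($) x) = 0" "x2 \<in> Z 2" "F2 (($) x2) \<noteq> 0"
    using ex[of 1] by (auto simp: numeral_2_eq_2)
  obtain F3 x3 where F3: "polyfun UNIV F3" "\<And>x. x \<in> Z 2 \<Longrightarrow> F3 (($) x) = 0" "x3 \<in> Z 3" "F3 (($) x3) \<noteq> 0"
    using ex[of 2] by (auto simp: numeral_3_eq_3 numeral_2_eq_2)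
  have ss: "Z 0 \<subseteq> Z 1" "Z 1 \<subseteq> Z 2" "Z 2 \<subseteq> Z 3"
    using sub[of 0] sub[of 1] sub[of 2] by (auto simp: numeral_3_eq_3 numeral_2_eq_2)
  have "\<exists>x\<in>V. poly (poly (poly P [:[:F3 (($) x):]:]) [:F2 (($) x):]) (F1 (($) x)) \<noteq> 0"
    if P: "P \<noteq> 0" for P
  proof (rule ccontr)
    assume "\<not> ?thesis"
    then have van: "\<And>x. x \<in> Z 3 \<Longrightarrow> poly (poly (poly P [:[:F3 (($) x):]:]) [:F2 (($) x):]) (F1 (($) x)) = 0"
      using irr(2)[of 3] by blast
    have pf1: "polyfun UNIV (\<lambda>c. poly r (F1 c))" for r
      using F1(1) by (rule polyfun_poly)
    have pf2: "polyfun UNIV (\<lambda>c. poly (poly r [:F2 c:]) (F1 c))" for r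
      by (induction r) (auto intro!: polyfun_intros F2(1) pf1)
    have "\<exists>r. r \<noteq> 0 \<and> (\<forall>x\<in>Z 2. poly (poly r [:F2 (($) x):]) (F1 (($) x)) = 0)"
      by (rule chain_independence_step[where val = "\<lambda>c P. poly (poly (poly P [:[:F3 c:]:]) [:F2 c:]) (F1 c)"
            and ev = "\<lambda>c r. poly (poly r [:F2 c:]) (F1 c)", OF irr(1)[of 3] ss(3) F3 pf2 _ _ P van]) auto
    then obtain P2 where P2: "P2 \<noteq> 0" "\<And>x. x \<in> Z 2 \<Longrightarrow> poly (poly P2 [:F2 (($) x):]) (F1 (($) x)) = 0"
      by blast
    have "\<exists>r. r \<noteq> 0 \<and> (\<forall>x\<in>Z 1. poly r (F1 (($) x)) = 0)"
      by (rule chain_independence_step[where val = "\<lambda>c P. poly (poly P [:F2 c:]) (F1 c)"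
            and ev = "\<lambda>c r. poly r (F1 c)", OF irr(1)[of 2] ss(2) F2 pf1 _ _ P2]) auto
    then obtain P1 where P1: "P1 \<noteq> 0" "\<And>x. x \<in> Z 1 \<Longrightarrow> poly P1 (F1 (($) x)) = 0"
      by blast
    have "\<exists>r :: 'k. r \<noteq> 0 \<and> (\<forall>x\<in>Z 0. r = 0)"
      by (rule chain_independence_step[where val = "\<lambda>c P. poly P (F1 c)"
            and ev = "\<lambda>c r. r", OF irr(1)[of 1] ss(1) F1 _ _ _ P1]) auto
    then show False using irr(1)[of 0] unfolding irreducible_variety_def by auto
  qed
  then show ?thesis using F1(1) F2(1) F3(1) by blast
qed

lemma underdetermined_system:
  fixes M :: "'e \<Rightarrow> 'i \<Rightarrow> 'k::field"
  assumes "finite E" "finite I" "card E < card I"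
  shows "\<exists>x. (\<exists>i\<in>I. x i \<noteq> 0) \<and> (\<forall>e\<in>E. (\<Sum>i\<in>I. x i * M e i) = 0)"
  using assms
proof (induction E arbitrary: M I rule: finite_induct)
  case empty
  then have "I \<noteq> {}" by auto
  then show ?case by (intro exI[of _ "\<lambda>_. 1"]) auto
next
  case (insert e0 E)
  show ?case
  proof (cases "\<forall>i\<in>I. M e0 i = 0")
    case True
    have "card E < card I" using insert by simp
    from insert.IH[OF insert.prems(1) this, of M] show ?thesis using True by auto
  next
    case False
    then obtain i0 where i0: "i0 \<in> I" "M e0 i0 \<noteq> 0" by blast
    \<comment> \<open>The equation \<open>e0\<close> is solved for the unknown \<open>i0\<close> and substituted into the others.\<close>
    define N where "N e i = M e i - M e i0 * M e0 i / M e0 i0" for e i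
    have "card E < card (I - {i0})" using insert i0 by simp
    from insert.IH[OF _ this, of N] insert.prems obtain x where
      x: "\<exists>i\<in>I - {i0}. x i \<noteq> 0" "\<forall>e\<in>E. (\<Sum>i\<in>I - {i0}. x i * N e i) = 0" by auto
    define y where "y = x(i0 := - (\<Sum>i\<in>I - {i0}. x i * M e0 i) / M e0 i0)"
    have sum_y: "(\<Sum>i\<in>I. y i * M e i) = (\<Sum>i\<in>I - {i0}. x i * N e i)" for e
    proof -
      have "(\<Sum>i\<in>I. y i * M e i) = y i0 * M e i0 + (\<Sum>i\<in>I - {i0}. y i * M e i)"
        using i0 insert.prems by (simp add: sum.remove)
      also have "(\<Sum>i\<in>I - {i0}. y i * M e i) = (\<Sum>i\<in>I - {i0}. x i * M e i)"
        by (intro sum.cong) (auto simp: y_def)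
      also have "y i0 * M e i0 = - (\<Sum>i\<in>I - {i0}. x i * (M e i0 * M e0 i / M e0 i0))"
        by (simp add: y_def sum_divide_distrib sum_distrib_left mult_ac)
      finally show ?thesis by (simp add: N_def right_diff_distrib sum_subtractf)
    qed
    have "\<forall>e\<in>insert e0 E. (\<Sum>i\<in>I. y i * M e i) = 0"
      using x(2) i0(2) by (auto simp: sum_y N_def)
    moreover have "\<exists>i\<in>I. y i \<noteq> 0" using x(1) by (auto simp: y_def)
    ultimately show ?thesis by blast
  qed
qed

text \<open>An element of \<open>K[t][s]\<close> stands for a polynomial in two variables, with \<open>s\<close> as the outer one. Its value at
  \<open>(t, s)\<close> is \<open>poly (poly Q [:s:]) t\<close>, which makes evaluation a ring homomorphism by simplification alone.\<close>

definition bidegree_le :: "nat \<Rightarrow> 'k::comm_ring_1 poly poly \<Rightarrow> bool" where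
  "bidegree_le N Q \<longleftrightarrow> (\<forall>i j. (i > N \<or> j > N) \<longrightarrow> coeff (coeff Q i) j = 0)"

lemma bidegree_le_ex: "\<exists>N. bidegree_le N Q"
proof -
  have "finite (degree ` coeff Q ` {..degree Q})" by simp
  then obtain n where n: "\<And>i. i \<le> degree Q \<Longrightarrow> degree (coeff Q i) \<le> n"
    by (metis (no_types, lifting) Max_ge atMost_iff image_eqI)
  have "bidegree_le (max n (degree Q)) Q"
    unfolding bidegree_le_def
  proof (intro allI impI)
    fix i j assume "i > max n (degree Q) \<or> j > max n (degree Q)"
    then show "coeff (coeff Q i) j = 0"
      using n[of i] by (cases "i \<le> degree Q") (auto simp: coeff_eq_0)
  qed
  then show ?thesis ..
qed

lemma bidegree_le_mono: "bidegree_le N Q \<Longrightarrow> N \<le> M \<Longrightarrow> bidegree_le M Q"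
  by (auto simp: bidegree_le_def)

lemma bidegree_le_mult:
  assumes "bidegree_le N P" "bidegree_le M Q" shows "bidegree_le (N + M) (P * Q)"
  unfolding bidegree_le_def
proof (intro allI impI)
  fix i j assume ij: "i > N + M \<or> j > N + M"
  have "coeff (coeff P k) l * coeff (coeff Q (i - k)) (j - l) = 0" if "k \<le> i" "l \<le> j" for k l
    using assms ij that unfolding bidegree_le_def
    by (cases "k > N \<or> l > N") (auto dest: spec[of _ "i - k"] spec[of _ "j - l"])
  then show "coeff (coeff (P * Q) i) j = 0"
    by (simp add: coeff_mult coeff_sum)
qed

lemma bidegree_le_power:
  assumes "bidegree_le N P" shows "bidegree_le (k * N) (P ^ k)"
proof (induction k)
  case 0
  show ?case by (auto simp: bidegree_le_def coeff_1)
qed (use bidegree_le_mult[OF assms] in simp)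

text \<open>There are \<open>(m + 1)\<^sup>3\<close> monomials of degree at most \<open>m\<close> in each of \<open>Q1\<close>, \<open>Q2\<close>, \<open>Q3\<close>, and they lie in a
  space of dimension \<open>(3mN + 1)\<^sup>2\<close>, where \<open>N\<close> bounds the bidegrees. For large \<open>m\<close> there are too many of them
  to be linearly independent.\<close>

lemma three_bivariate_dependent:
  fixes Q1 Q2 Q3 :: "'k::field_char_0 poly poly"
  shows "\<exists>P. P \<noteq> 0 \<and> (\<forall>t s. poly (poly (poly P [:[:poly (poly Q3 [:s:]) t:]:])
    [:poly (poly Q2 [:s:]) t:]) (poly (poly Q1 [:s:]) t) = 0)"
proof -
  obtain N1 N2 N3 where N: "bidegree_le N1 Q1" "bidegree_le N2 Q2" "bidegree_le N3 Q3"
    using bidegree_le_ex by metis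
  define N where "N = Suc (N1 + N2 + N3)"
  have bN: "bidegree_le N Q1" "bidegree_le N Q2" "bidegree_le N Q3"
    using N by (auto intro: bidegree_le_mono simp: N_def)
  \<comment> \<open>With this \<open>m\<close>, \<open>(3mN + 1)\<^sup>2 \<le> 9 N\<^sup>2 (m + 1)\<^sup>2 < (m + 1)\<^sup>3\<close>.\<close>
  define m where "m = 9 * N ^ 2"
  define M where "M = 3 * (m * N)"
  define E where "E = {..M} \<times> {..M}"
  define I where "I = {..m} \<times> {..m} \<times> {..m}"
  define T where "T = (\<lambda>(a, b, d). Q1 ^ a * Q2 ^ b * Q3 ^ d)"
  have bT: "bidegree_le M (T i)" if "i \<in> I" for i
  proof -
    obtain a b d where i: "i = (a, b, d)" "a \<le> m" "b \<le> m" "d \<le> m" using \<open>i \<in> I\<close> by (auto simp: I_def)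
    have "bidegree_le (m * N) (Q ^ a)" if "a \<le> m" "bidegree_le N Q" for a Q
      by (rule bidegree_le_mono[OF bidegree_le_power[OF that(2), of a]]) (simp add: that(1))
    then have "bidegree_le (m * N + m * N + m * N) (Q1 ^ a * Q2 ^ b * Q3 ^ d)"
      using i bN by (intro bidegree_le_mult) auto
    moreover have "m * N + m * N + m * N = M" by (simp add: M_def)
    ultimately show ?thesis by (simp add: i T_def)
  qed
  have "3 * N * (m + 1) = M + 3 * N" by (simp add: M_def algebra_simps)
  then have "M + 1 \<le> 3 * N * (m + 1)" by (simp add: N_def)
  then have "(M + 1) ^ 2 \<le> (3 * N * (m + 1)) ^ 2" by (rule power_mono) simp
  also have "\<dots> = 9 * N ^ 2 * (m + 1) ^ 2" by (simp only: power_mult_distrib) simp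
  also have "\<dots> = m * (m + 1) ^ 2" by (simp only: m_def)
  also have "\<dots> < (m + 1) * (m + 1) ^ 2" by (intro mult_strict_right_mono) auto
  finally have "card E < card I"
    unfolding E_def I_def by (simp add: card_cartesian_product power2_eq_square)
  then obtain x where x: "\<exists>i\<in>I. x i \<noteq> 0"
    "\<forall>e\<in>E. (\<Sum>i\<in>I. x i * (\<lambda>e i. coeff (coeff (T i) (fst e)) (snd e)) e i) = 0"
    using underdetermined_system[of E I "\<lambda>e i. coeff (coeff (T i) (fst e)) (snd e)"]
    by (auto simp: E_def I_def)
  have S0: "(\<Sum>i\<in>I. smult [:x i:] (T i)) = 0"
  proof (intro poly_eqI)
    fix k l
    show "coeff (coeff (\<Sum>i\<in>I. smult [:x i:] (T i)) k) l = coeff (coeff 0 k) l"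
    proof (cases "(k, l) \<in> E")
      case True
      then show ?thesis using x(2) by (fastforce simp: coeff_sum)
    next
      case False
      then have "coeff (coeff (T i) k) l = 0" if "i \<in> I" for i
        using bT[OF that] unfolding bidegree_le_def E_def by auto
      then show ?thesis by (simp add: coeff_sum)
    qed
  qed
  define P where "P = (\<Sum>(a, b, d)\<in>I. monom (monom (monom (x (a, b, d)) a) b) d)"
  have "coeff (coeff (coeff P d) b) a = x (a, b, d)" if "(a, b, d) \<in> I" for a b d
  proof -
    have "coeff (coeff (coeff P d) b) a = (\<Sum>i\<in>I. if i = (a, b, d) then x i else 0)"
      unfolding P_def by (simp add: coeff_sum case_prod_beta) (intro sum.cong, auto)
    then show ?thesis using that by (simp add: I_def)
  qed
  then have "P \<noteq> 0" using x(1) by (auto simp: I_def)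
  moreover have "poly (poly (poly P [:[:v3:]:]) [:v2:]) v1 = 0"
    if v: "v1 = poly (poly Q1 [:s:]) t" "v2 = poly (poly Q2 [:s:]) t" "v3 = poly (poly Q3 [:s:]) t"
    for v1 v2 v3 s t
  proof -
    have "poly (poly (poly P [:[:v3:]:]) [:v2:]) v1 = (\<Sum>(a, b, d)\<in>I. x (a, b, d) * v1 ^ a * v2 ^ b * v3 ^ d)"
      unfolding P_def by (simp add: poly_sum poly_monom case_prod_beta)
    also have "\<dots> = poly (poly (\<Sum>i\<in>I. smult [:x i:] (T i)) [:s:]) t"
      unfolding v by (simp add: poly_sum T_def case_prod_beta mult_ac)
    also have "\<dots> = 0" by (simp only: S0 poly_0)
    finally show ?thesis .
  qed
  ultimately show ?thesis by blast
qed

lemma bivariate_subst: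
  fixes Q :: "'v \<Rightarrow> 'k::field_char_0 poly poly"
  shows "\<exists>P. \<forall>t s. mpoly_eval f (\<lambda>i. poly (poly (Q i) [:s:]) t) = poly (poly P [:s:]) t"
proof (induction f rule: mpoly_ring_induct)
  case (const a)
  show ?case by (intro exI[of _ "[:[:a:]:]"]) simp
next
  case (var i)
  show ?case by (intro exI[of _ "Q i"]) simp
next
  case (add p q)
  then obtain P P' where "\<forall>t s. mpoly_eval p (\<lambda>i. poly (poly (Q i) [:s:]) t) = poly (poly P [:s:]) t"
    "\<forall>t s. mpoly_eval q (\<lambda>i. poly (poly (Q i) [:s:]) t) = poly (poly P' [:s:]) t" by blast
  then show ?case by (intro exI[of _ "P + P'"]) (simp add: mpoly_eval_add)
next
  case (mult p q)
  then obtain P P' where "\<forall>t s. mpoly_eval p (\<lambda>i. poly (poly (Q i) [:s:]) t) = poly (poly P [:s:]) t"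
    "\<forall>t s. mpoly_eval q (\<lambda>i. poly (poly (Q i) [:s:]) t) = poly (poly P' [:s:]) t" by blast
  then show ?case by (intro exI[of _ "P * P'"]) (simp add: mpoly_eval_mult)
qed

text \<open>Functions on \<open>V\<close> pull back to polynomials in \<open>t\<close> and \<open>s\<close>, so no three of them are algebraically
  independent, as a longer chain would require.\<close>

lemma dimension_parametrized_surface:
  fixes V :: "('k::field_char_0 ^ 'n) set"
  assumes "V \<subseteq> {\<chi> i. poly (poly (Q i) [:s:]) t | s t. True}"
  shows "dimension V \<le> 2"
proof -
  have "dimension V \<le> enat 2"
  proof (rule dimension_le, rule ccontr)
    fix k Z assume Z: "irreducible_chain k Z V" and "\<not> k \<le> 2"
    then have "irreducible_chain 3 Z V" unfolding irreducible_chain_def by auto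
    from chain_algebraically_independent[OF this] obtain F1 F2 F3 where
      F: "polyfun UNIV F1" "polyfun UNIV F2" "polyfun UNIV F3" and
      ind: "\<And>P. P \<noteq> 0 \<Longrightarrow> \<exists>x\<in>V. poly (poly (poly P [:[:F3 (($) x):]:]) [:F2 (($) x):]) (F1 (($) x)) \<noteq> 0"
      by blast
    have "\<exists>P. \<forall>t s. F (\<lambda>i. poly (poly (Q i) [:s:]) t) = poly (poly P [:s:]) t" if "polyfun UNIV F" for F
      using that bivariate_subst[of _ Q] unfolding polyfun_def by blast
    then obtain Q1 Q2 Q3 where Q: "\<And>t s. F1 (\<lambda>i. poly (poly (Q i) [:s:]) t) = poly (poly Q1 [:s:]) t"
      "\<And>t s. F2 (\<lambda>i. poly (poly (Q i) [:s:]) t) = poly (poly Q2 [:s:]) t"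
      "\<And>t s. F3 (\<lambda>i. poly (poly (Q i) [:s:]) t) = poly (poly Q3 [:s:]) t"
      using F by metis
    obtain P where P: "P \<noteq> 0" "\<And>t s. poly (poly (poly P [:[:poly (poly Q3 [:s:]) t:]:])
      [:poly (poly Q2 [:s:]) t:]) (poly (poly Q1 [:s:]) t) = 0"
      using three_bivariate_dependent[of Q3 Q2 Q1] by blast
    obtain x where x: "x \<in> V" "poly (poly (poly P [:[:F3 (($) x):]:]) [:F2 (($) x):]) (F1 (($) x)) \<noteq> 0"
      using ind[OF P(1)] by blast
    obtain s t where "x = (\<chi> i. poly (poly (Q i) [:s:]) t)" using x(1) assms by blast
    then have "($) x = (\<lambda>i. poly (poly (Q i) [:s:]) t)" by (simp add: fun_eq_iff)
    then show False using x(2) P(2) by (simp add: Q)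
  qed
  then show ?thesis by (simp add: numeral_eq_enat)
qed

section \<open>The tangent bundle of an immersed curve\<close>

definition velocity :: "'k::field_char_0 poly ^ 'n \<Rightarrow> 'k \<Rightarrow> 'k ^ 'n" where
  "velocity g t = (\<chi> i. poly (pderiv (g $ i)) t)"

lemma velocity_nth [simp]: "velocity g t $ i = poly (pderiv (g $ i)) t"
  by (simp add: velocity_def)

lemma chain_rule:
  "poly (pderiv (pull (($) g) f)) t = (\<Sum>i\<in>UNIV. gradient f (curve_point g t) $ i * velocity g t $ i)"
proof (induction f rule: mpoly_ring_induct)
  case (const a)
  show ?case by simp
next
  case (var j)
  have "(\<Sum>i\<in>UNIV. axis j 1 $ i * velocity g t $ i) = (\<Sum>i\<in>UNIV. if i = j then velocity g t $ i else 0)"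
    by (intro sum.cong) (auto simp: axis_def)
  then show ?case by simp
next
  case (add f h)
  then show ?case by (simp add: pull_add pderiv_add gradient_add distrib_right sum.distrib)
next
  case (mult f h)
  then show ?case
    by (simp add: pull_mult pderiv_mult gradient_mult distrib_right sum.distrib eval_curve_point
        mult.assoc flip: sum_distrib_left)
qed

lemma velocity_in_tangent_space:
  "velocity g t \<in> tangent_space (range (curve_point g)) (curve_point g t)"
  unfolding tangent_space_gradient
proof (intro CollectI ballI)
  fix f assume "f \<in> vanishing_ideal (range (curve_point g))"
  then have "poly (pull (($) g) f) t = 0" for t
    by (auto simp: vanishing_ideal_def eval_curve_point)
  then have "pull (($) g) f = 0" using poly_all_0_iff_0 by blast
  then show "(\<Sum>i\<in>UNIV. gradient f (curve_point g t) $ i * velocity g t $ i) = 0"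
    by (simp add: chain_rule[of g f t, symmetric] del: velocity_nth)
qed

lemma tangent_space_curve:
  assumes dim: "vec.dim (tangent_space (range (curve_point g)) (curve_point g t)) = 1"
    and "velocity g t \<noteq> 0"
  shows "tangent_space (range (curve_point g)) (curve_point g t) = range (\<lambda>s. s *s velocity g t)"
proof -
  let ?T = "tangent_space (range (curve_point g)) (curve_point g t)"
  have "?T \<subseteq> vec.span {velocity g t}"
    using assms velocity_in_tangent_space[of g t]
    by (intro vec.card_ge_dim_independent) (auto simp: vec.independent_insert)
  moreover have "vec.span {velocity g t} \<subseteq> ?T"
    using velocity_in_tangent_space[of g t] by (intro vec.span_minimal subspace_tangent_space) simp
  ultimately show ?thesis by (auto simp: vec.span_singleton)
qed

lemma closedin_tangent_bundle:
  assumes "closedin zariski V" shows "closedin zariski (tangent_bundle V)"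
proof -
  let ?S1 = "(\<lambda>f c. mpoly_eval f (\<lambda>i. c (Inl i))) ` vanishing_ideal V"
  let ?S2 = "(\<lambda>f c. \<Sum>i\<in>UNIV. mpoly_eval (partial i f) (\<lambda>i. c (Inl i)) * c (Inr i)) ` vanishing_ideal V"
  have V: "x \<in> V \<longleftrightarrow> (\<forall>f\<in>vanishing_ideal V. mpoly_eval f (($) x) = 0)" for x
    using closed_polyfun_separates[OF assms] by (auto simp: vanishing_ideal_def)
  have ext: "($) (\<chi> i. z $ Inl i) = (\<lambda>i. z $ Inl i)" for z :: "'a ^ ('b + 'b)"
    by (simp add: fun_eq_iff)
  have "tangent_bundle V = {z. \<forall>F\<in>?S1 \<union> ?S2. F (($) z) = 0}"
    unfolding tangent_bundle_def V ball_Un ball_simps tangent_space_def mem_Collect_eq ext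
    by simp
  also have "closedin zariski \<dots>"
    by (rule closedin_polyfuns) (auto intro!: polyfun_intros polyfun_subst)
  finally show ?thesis .
qed

definition bundle_point :: "'k poly ^ 'n \<Rightarrow> 'k \<Rightarrow> 'k \<Rightarrow> 'k::field_char_0 ^ ('n + 'n)" where
  "bundle_point g t s = (\<chi> k. case k of Inl i \<Rightarrow> curve_point g t $ i | Inr i \<Rightarrow> s * velocity g t $ i)"

lemma bundle_point_nth [simp]:
  "bundle_point g t s $ Inl i = poly (g $ i) t"
  "bundle_point g t s $ Inr i = s * poly (pderiv (g $ i)) t"
  by (simp_all add: bundle_point_def)

text \<open>At every point the tangent space is a line, and the velocity is a nonzero vector on it.\<close>

lemma tangent_bundle_curve:
  assumes "\<And>t. vec.dim (tangent_space (range (curve_point g)) (curve_point g t)) = 1"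
    and "\<And>t. velocity g t \<noteq> 0"
  shows "tangent_bundle (range (curve_point g)) = {bundle_point g t s | t s. True}"
proof -
  have "z \<in> tangent_bundle (range (curve_point g)) \<longleftrightarrow> (\<exists>t s. z = bundle_point g t s)" for z
  proof
    assume z: "z \<in> tangent_bundle (range (curve_point g))"
    then obtain t where t: "(\<chi> i. z $ Inl i) = curve_point g t" by (auto simp: tangent_bundle_def)
    then have "(\<chi> i. z $ Inr i) \<in> range (\<lambda>s. s *s velocity g t)"
      using z tangent_space_curve[OF assms] by (simp add: tangent_bundle_def)
    then obtain s where "(\<chi> i. z $ Inr i) = s *s velocity g t" by blast
    then have "z $ k = bundle_point g t s $ k" for k
      using t by (cases k) (simp_all add: vec_eq_iff)
    then show "\<exists>t s. z = bundle_point g t s" by (auto simp: vec_eq_iff)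
  next
    assume "\<exists>t s. z = bundle_point g t s"
    then obtain t s where z: "z = bundle_point g t s" by blast
    have 1: "(\<chi> i. z $ Inl i) = curve_point g t" "(\<chi> i. z $ Inr i) = s *s velocity g t"
      by (simp_all add: z vec_eq_iff)
    then show "z \<in> tangent_bundle (range (curve_point g))"
      unfolding tangent_bundle_def mem_Collect_eq 1 tangent_space_curve[OF assms] by blast
  qed
  then show ?thesis by blast
qed

lemma irreducible_tangent_bundle:
  assumes TC: "closedin zariski {bundle_point g t s | t s. True}"
  shows "irreducible_variety {bundle_point g t s | t s. True}"
proof -
  let ?\<Phi> = "\<lambda>c. bundle_point g (c False) (c True)"
  have "bundle_point g t s \<in> range ?\<Phi>" for t s
    by (rule image_eqI[of _ _ "\<lambda>b. if b then s else t"]) auto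
  then have eq: "{bundle_point g t s | t s. True} = range ?\<Phi>" by auto
  have "irreducible_variety (range ?\<Phi>)"
  proof (rule irreducible_image)
    show "polyfun UNIV (\<lambda>c. ?\<Phi> c $ k)" for k
      by (cases k) (auto intro!: polyfun_intros polyfun_poly)
  qed (use TC eq in simp)
  then show ?thesis by (simp only: eq)
qed

text \<open>The lower bound comes from the chain consisting of the origin of one fibre, that fibre, and the whole bundle.
  The fibre is closed because it is cut out of the bundle by fixing the base point.\<close>

lemma dimension_tangent_bundle:
  fixes g :: "'k::{alg_closed_field, field_char_0} poly ^ 'n"
  assumes TC: "closedin zariski {bundle_point g t s | t s. True}"
    and i0: "degree (g $ i0) > 0" and vel: "\<And>t. velocity g t \<noteq> 0"
    and fib: "\<And>t. vec.dim (tangent_space (range (curve_point g)) (curve_point g t)) = 1"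
  shows "dimension {bundle_point g t s | t s. True} = 2"
proof (rule antisym)
  let ?TC = "{bundle_point g t s | t s. True}"
  define Q where "Q k = (case k of Inl i \<Rightarrow> [:g $ i:] | Inr i \<Rightarrow> [:0, pderiv (g $ i):])" for k
  have "bundle_point g t s = (\<chi> k. poly (poly (Q k) [:s:]) t)" for t s
    unfolding vec_eq_iff by (auto simp: Q_def split: sum.splits)
  then show "dimension ?TC \<le> 2"
    by (intro dimension_parametrized_surface[of _ Q]) auto
  let ?L = "range (bundle_point g 0)"
  obtain t1 where t1: "curve_point g t1 \<noteq> curve_point g 0"
    using finite_fibre[OF i0, of "curve_point g 0"] infinite_UNIV_char_0
    by (metis (mono_tags, lifting) UNIV_I finite_subset mem_Collect_eq subsetI)
  have "?L = ?TC \<inter> {z. \<forall>F\<in>range (\<lambda>i c. c (Inl i) - curve_point g 0 $ i). F (($) z) = 0}"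
  proof (intro equalityI subsetI)
    fix z assume z: "z \<in> ?TC \<inter> {z. \<forall>F\<in>range (\<lambda>i c. c (Inl i) - curve_point g 0 $ i). F (($) z) = 0}"
    then obtain t s where ts: "z = bundle_point g t s" by blast
    then have t: "curve_point g t = curve_point g 0" using z by (simp add: vec_eq_iff)
    have "s *s velocity g t \<in> range (\<lambda>s. s *s velocity g t)" by blast
    also have "\<dots> = tangent_space (range (curve_point g)) (curve_point g 0)"
      using tangent_space_curve[OF fib[of t] vel] t by simp
    also have "\<dots> = range (\<lambda>s. s *s velocity g 0)" by (rule tangent_space_curve[OF fib vel])
    finally obtain s' where s': "s *s velocity g t = s' *s velocity g 0" by blast
    have "z $ k = bundle_point g 0 s' $ k" for k
      using t s' by (cases k) (simp_all add: ts vec_eq_iff)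
    then have "z = bundle_point g 0 s'" by (simp add: vec_eq_iff)
    then show "z \<in> ?L" by blast
  qed auto
  also have "closedin zariski \<dots>"
    by (intro closedin_Int TC closedin_polyfuns) (auto intro!: polyfun_intros)
  finally have L: "closedin zariski ?L" .
  have eqL: "?L = range (\<lambda>c :: unit \<Rightarrow> 'k. bundle_point g 0 (c ()))"
  proof -
    have "bundle_point g 0 s \<in> range (\<lambda>c :: unit \<Rightarrow> 'k. bundle_point g 0 (c ()))" for s
      by (rule image_eqI[of _ _ "\<lambda>_. s"]) auto
    then show ?thesis by auto
  qed
  have irrL: "irreducible_variety ?L"
    unfolding eqL
  proof (rule irreducible_image)
    show "polyfun UNIV (\<lambda>c :: unit \<Rightarrow> 'k. bundle_point g 0 (c ()) $ k)" for k
      by (cases k) (auto intro!: polyfun_intros)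
  qed (use L eqL in simp)
  define Z where "Z i = (if i = 0 then {bundle_point g 0 0} else if i = 1 then ?L else ?TC)" for i :: nat
  have strict1: "{bundle_point g 0 0} \<subset> ?L"
  proof -
    obtain i where "velocity g 0 $ i \<noteq> 0" using vel[of 0] by (auto simp: vec_eq_iff)
    then have "bundle_point g 0 1 $ Inr i \<noteq> bundle_point g 0 0 $ Inr i" by simp
    then have "bundle_point g 0 1 \<noteq> bundle_point g 0 0" by metis
    then show ?thesis by blast
  qed
  have strict2: "?L \<subset> ?TC"
  proof -
    obtain i where "curve_point g t1 $ i \<noteq> curve_point g 0 $ i" using t1 by (auto simp: vec_eq_iff)
    then have "bundle_point g t1 0 $ Inl i \<noteq> bundle_point g 0 s $ Inl i" for s by simp
    then have "bundle_point g t1 0 \<notin> ?L" by force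
    then show ?thesis by blast
  qed
  have "irreducible_chain 2 Z ?TC"
    unfolding irreducible_chain_def
  proof (intro conjI allI impI)
    fix i :: nat assume "i < 2"
    then have "i = 0 \<or> i = 1" by auto
    then show "Z i \<subset> Z (Suc i)" using strict1 strict2 by (auto simp only: Z_def) auto
  next
    fix i :: nat
    show "irreducible_variety (Z i)"
      using irrL irreducible_point irreducible_tangent_bundle[OF TC]
      by (simp only: Z_def split: if_split) blast
    show "Z i \<subseteq> ?TC" unfolding Z_def by auto
  qed
  from dimension_ge[OF this] show "2 \<le> dimension ?TC" by (simp add: numeral_eq_enat)
qed

section \<open>Computing the geometric degree\<close>

text \<open>The vectors \<open>w k\<close> witness that the equations are independent: \<open>w k\<close> satisfies the homogeneous equations
  before number \<open>k\<close> but not that equation, so each equation lowers the dimension by exactly one.\<close>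

lemma affine_linear_system:
  fixes c :: "nat \<times> 'n::finite option \<Rightarrow> 'k::field"
  assumes w: "\<And>k. k < d \<Longrightarrow> (\<forall>i<k. (\<Sum>j\<in>UNIV. c (i, Some j) * w k $ j) = 0) \<and>
      (\<Sum>j\<in>UNIV. c (k, Some j) * w k $ j) \<noteq> 0"
  shows "affine_linear_variety (CARD('n) - d) (linear_system d c :: ('k ^ 'n) set)"
proof -
  define \<phi> where "\<phi> i x = (\<Sum>j\<in>UNIV. c (i, Some j) * x $ j)" for i and x :: "'k ^ 'n"
  have \<phi>_add: "\<phi> i (x + y) = \<phi> i x + \<phi> i y" for i x y
    by (simp add: \<phi>_def algebra_simps sum.distrib)
  have \<phi>_smult: "\<phi> i (a *s x) = a * \<phi> i x" for i a x
    by (simp add: \<phi>_def sum_distrib_left mult_ac)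
  have \<phi>_zero: "\<phi> i 0 = 0" for i by (simp add: \<phi>_def)
  define W where "W k = {x. \<forall>i<k. \<phi> i x = 0}" for k
  have sub: "vec.subspace (W k)" for k
    by (auto simp: vec.subspace_def W_def \<phi>_add \<phi>_smult \<phi>_zero)
  have w1: "w k \<in> W k" "\<phi> k (w k) \<noteq> 0" if "k < d" for k
    using w[OF that] by (simp_all add: W_def \<phi>_def)
  have dim: "vec.dim (W k) + k = CARD('n)" if "k \<le> d" for k
    using that
  proof (induction k)
    case 0
    have "W 0 = UNIV" by (simp add: W_def)
    then show ?case by (simp only: vec_dim_card add_0_right)
  next
    case (Suc k)
    have k: "k < d" using Suc by simp
    have Wk: "W k = vec.span (insert (w k) (W (Suc k)))"
    proof
      have "W (Suc k) \<subseteq> W k" by (auto simp: W_def)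
      then show "vec.span (insert (w k) (W (Suc k))) \<subseteq> W k"
        using w1[OF k] sub by (intro vec.span_minimal) auto
      show "W k \<subseteq> vec.span (insert (w k) (W (Suc k)))"
      proof
        fix x assume x: "x \<in> W k"
        define a where "a = \<phi> k x / \<phi> k (w k)"
        have "x - a *s w k = x + (- a) *s w k" by simp
        then have "\<phi> i (x - a *s w k) = \<phi> i x - a * \<phi> i (w k)" for i
          by (simp only: \<phi>_add \<phi>_smult) simp
        then have "x - a *s w k \<in> W (Suc k)"
          using x w1[OF k] by (auto simp: W_def less_Suc_eq a_def)
        then show "x \<in> vec.span (insert (w k) (W (Suc k)))"
          unfolding vec.span_insert using vec.span_base by blast
      qed
    qed
    have "vec.span (W (Suc k)) = W (Suc k)" using sub vec.span_eq_iff by blast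
    moreover have "w k \<notin> W (Suc k)" using w1[OF k] by (auto simp: W_def)
    ultimately have "w k \<notin> vec.span (W (Suc k))" by metis
    then have "vec.dim (W k) = vec.dim (W (Suc k)) + 1"
      unfolding Wk vec.dim_span by (simp add: vec.dim_insert)
    then show ?case using Suc by simp
  qed
  have "\<exists>a. \<forall>i<k. \<phi> i a = c (i, None)" if "k \<le> d" for k
    using that
  proof (induction k)
    case (Suc k)
    then obtain a where a: "\<forall>i<k. \<phi> i a = c (i, None)" by auto
    have k: "k < d" using Suc by simp
    define b where "b = (c (k, None) - \<phi> k a) / \<phi> k (w k)"
    have "\<forall>i<Suc k. \<phi> i (a + b *s w k) = c (i, None)"
      using a w1[OF k] by (auto simp: \<phi>_add \<phi>_smult W_def less_Suc_eq b_def)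
    then show ?case by blast
  qed auto
  then obtain a where a: "\<forall>i<d. \<phi> i a = c (i, None)" by blast
  have "linear_system d c = (\<lambda>w. a + w) ` W d"
  proof (intro equalityI subsetI)
    fix x assume "x \<in> linear_system d c"
    then have "\<forall>i<d. \<phi> i x = c (i, None)" by (simp add: linear_system_def \<phi>_def)
    moreover have "\<phi> i x = \<phi> i a + \<phi> i (x - a)" for i using \<phi>_add[of i a "x - a"] by simp
    ultimately have "x - a \<in> W d" using a by (auto simp: W_def)
    moreover have "x = a + (x - a)" by simp
    ultimately show "x \<in> (\<lambda>w. a + w) ` W d" by blast
  next
    fix x assume "x \<in> (\<lambda>w. a + w) ` W d"
    then have "\<forall>i<d. \<phi> i x = c (i, None)" using a by (auto simp: W_def \<phi>_add)
    then show "x \<in> linear_system d c" by (simp add: linear_system_def \<phi>_def)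
  qed
  moreover have "vec.dim (W d) = CARD('n) - d" using dim[of d] by simp
  ultimately show ?thesis unfolding affine_linear_variety_def using sub by blast
qed

text \<open>The degree is well defined because two generic conditions, together with the generic condition that the
  equations define a space of the expected dimension, hold simultaneously for some coefficients.\<close>

lemma geometric_degree_eqI:
  fixes V :: "('k::field_char_0 ^ 'n) set"
  assumes V: "irreducible_variety V" "dimension V = enat d"
    and gen: "generic ({..<d} \<times> UNIV) (\<lambda>c. finite (V \<inter> linear_system d c) \<and> card (V \<inter> linear_system d c) = k)"
    and aff: "generic ({..<d} \<times> UNIV) (\<lambda>c. affine_linear_variety (CARD('n) - d) (linear_system d c :: ('k ^ 'n) set))"
  shows "geometric_degree V = k"
  unfolding geometric_degree_def
proof (rule the_equality)
  obtain f c0 where "indets f \<subseteq> {..<d} \<times> UNIV" "mpoly_eval f c0 \<noteq> 0"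
    "\<And>c. mpoly_eval f c \<noteq> 0 \<Longrightarrow> finite (V \<inter> linear_system d c) \<and> card (V \<inter> linear_system d c) = k"
    using gen unfolding generic_def polyfun_def by blast
  then have "generic_affine_linear d (\<lambda>L. finite (V \<inter> L) \<and> card (V \<inter> L) = k)"
    unfolding generic_affine_linear_def by (intro exI[of _ f]) auto
  then show "\<exists>d. irreducible_variety V \<and> dimension V = enat d \<and>
      generic_affine_linear d (\<lambda>L. finite (V \<inter> L) \<and> card (V \<inter> L) = k)" using V by blast
next
  fix k' assume "\<exists>d. irreducible_variety V \<and> dimension V = enat d \<and>
      generic_affine_linear d (\<lambda>L. finite (V \<inter> L) \<and> card (V \<inter> L) = k')"
  then have "generic_affine_linear d (\<lambda>L. finite (V \<inter> L) \<and> card (V \<inter> L) = k')" using V by auto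
  then obtain f :: "(nat \<times> 'n option, 'k) mpoly" where f: "f \<noteq> 0" "indets f \<subseteq> {..<d} \<times> UNIV"
    "\<And>c. mpoly_eval f c \<noteq> 0 \<Longrightarrow> affine_linear_variety (CARD('n) - d) (linear_system d c :: ('k ^ 'n) set) \<Longrightarrow>
      card (V \<inter> linear_system d c) = k'"
    unfolding generic_affine_linear_def by blast
  obtain c1 where "mpoly_eval f c1 \<noteq> 0" using mpoly_eval_nonzero[OF f(1)] by blast
  moreover have "polyfun ({..<d} \<times> UNIV) (mpoly_eval f)" using f(2) unfolding polyfun_def by blast
  ultimately have "generic ({..<d} \<times> UNIV) (\<lambda>c. mpoly_eval f c \<noteq> 0)" by (intro generic_polyfun)
  from generic_ex[OF generic_conj[OF this generic_conj[OF gen aff]]] show "k' = k" using f(3) by auto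
qed

lemma generic_affine_1:
  "generic ({..<1} \<times> UNIV) (\<lambda>c. affine_linear_variety (CARD('n) - 1) (linear_system 1 c :: ('k::field_char_0 ^ 'n) set))"
proof -
  obtain j :: 'n where True by blast
  have "generic ({..<1} \<times> UNIV) (\<lambda>c. c (0::nat, Some j) \<noteq> (0::'k))"
    by (rule generic_polyfun[of _ "\<lambda>c. c (0, Some j)" "\<lambda>_. 1"]) (auto intro: polyfun_var)
  then show ?thesis
  proof (rule generic_mono)
    fix c :: "nat \<times> 'n option \<Rightarrow> 'k" assume "c (0, Some j) \<noteq> 0"
    moreover have "(\<Sum>i\<in>UNIV. c (0, Some i) * axis j 1 $ i) = (\<Sum>i\<in>UNIV. if i = j then c (0, Some i) else 0)"
      by (intro sum.cong) (auto simp: axis_def)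
    ultimately show "affine_linear_variety (CARD('n) - 1) (linear_system 1 c :: ('k ^ 'n) set)"
      by (intro affine_linear_system[where w = "\<lambda>_. axis j 1"]) auto
  qed
qed

text \<open>Two equations are independent if a two by two minor of their coefficients does not vanish.\<close>

lemma generic_affine_2:
  fixes j0 j1 :: "'n::finite"
  assumes "j0 \<noteq> j1"
  shows "generic ({..<2} \<times> UNIV) (\<lambda>c. affine_linear_variety (CARD('n) - 2) (linear_system 2 c :: ('k::field_char_0 ^ 'n) set))"
proof -
  have "generic ({..<2} \<times> UNIV) (\<lambda>c. c (0::nat, Some j0) \<noteq> (0::'k))"
    by (rule generic_polyfun[of _ "\<lambda>c. c (0, Some j0)" "\<lambda>_. 1"]) (auto intro: polyfun_var)
  moreover have "generic ({..<2} \<times> UNIV)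
      (\<lambda>c. c (0::nat, Some j0) * c (1, Some j1) - c (0, Some j1) * c (1, Some j0) \<noteq> (0::'k))"
    by (rule generic_polyfun[of _ "\<lambda>c. c (0, Some j0) * c (1, Some j1) - c (0, Some j1) * c (1, Some j0)"
          "\<lambda>x. if x = (0, Some j0) \<or> x = (1, Some j1) then 1 else 0"])
      (use assms in \<open>auto intro!: polyfun_intros\<close>)
  ultimately have "generic ({..<2} \<times> UNIV) (\<lambda>c. c (0::nat, Some j0) \<noteq> (0::'k) \<and>
      c (0::nat, Some j0) * c (1, Some j1) - c (0, Some j1) * c (1, Some j0) \<noteq> (0::'k))"
    by (rule generic_conj)
  then show ?thesis
  proof (rule generic_mono)
    fix c :: "nat \<times> 'n option \<Rightarrow> 'k"
    assume c: "c (0, Some j0) \<noteq> 0 \<and> c (0, Some j0) * c (1, Some j1) - c (0, Some j1) * c (1, Some j0) \<noteq> 0"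
    have ax: "(\<Sum>i\<in>UNIV. c (r, Some i) * (a * axis j 1 $ i)) = a * c (r, Some j)" for r j a
    proof -
      have "(\<Sum>i\<in>UNIV. c (r, Some i) * (a * axis j 1 $ i)) = (\<Sum>i\<in>UNIV. if i = j then a * c (r, Some i) else 0)"
        by (intro sum.cong) (auto simp: axis_def)
      then show ?thesis by simp
    qed
    \<comment> \<open>\<open>w 1\<close> solves the first equation within the plane of the coordinates \<open>j0\<close> and \<open>j1\<close>.\<close>
    define w where "w k = (if k = 0 then axis j0 1
      else c (0, Some j0) *s axis j1 1 - c (0, Some j1) *s axis j0 1)" for k :: nat
    have w0: "(\<Sum>j\<in>UNIV. c (r, Some j) * w 0 $ j) = c (r, Some j0)" for r
      using ax[of r 1 j0] by (simp add: w_def)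
    have w1: "(\<Sum>j\<in>UNIV. c (r, Some j) * w 1 $ j) =
        c (0, Some j0) * c (r, Some j1) - c (0, Some j1) * c (r, Some j0)" for r
      by (simp add: w_def right_diff_distrib sum_subtractf ax)
    show "affine_linear_variety (CARD('n) - 2) (linear_system 2 c :: ('k ^ 'n) set)"
    proof (rule affine_linear_system[where w = w])
      fix k :: nat assume "k < 2"
      then have "k = 0 \<or> k = 1" by auto
      then show "(\<forall>i<k. (\<Sum>j\<in>UNIV. c (i, Some j) * w k $ j) = 0) \<and> (\<Sum>j\<in>UNIV. c (k, Some j) * w k $ j) \<noteq> 0"
      proof
        assume "k = 0"
        then show ?thesis using c w0 by simp
      next
        assume "k = 1"
        then show ?thesis using c w1[of 0] w1[of 1] by simp
      qed
    qed
  qed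
qed

section \<open>Counting roots of generic members of a family\<close>

lemma card_simple_roots:
  fixes p :: "'k::{alg_closed_field, field_char_0} poly"
  assumes "p \<noteq> 0" "\<nexists>t. poly p t = 0 \<and> poly (pderiv p) t = 0"
  shows "card {t. poly p t = 0} = degree p"
proof -
  obtain A where A: "size A = degree p" "p = smult (lead_coeff p) (\<Prod>x\<in>#A. [:-x, 1:])"
    using alg_closed_imp_factorization[OF assms(1)] by blast
  have "proots (\<Prod>x\<in>#A. [:-x, 1:]) = A"
  proof (induction A)
    case (add x A)
    have "(\<Prod>x\<in>#A. [:-x, 1:]) \<noteq> (0 :: 'k poly)" by (auto simp: prod_mset_zero_iff)
    then show ?case using add by (simp add: proots_mult del: mult_pCons_left)
  qed simp
  then have "proots p = A" using A(2) assms(1) by (metis leading_coeff_0_iff proots_smult)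
  then have "degree p = size (proots p)" using A(1) by simp
  also have "\<dots> = (\<Sum>x | poly p x = 0. order x p)"
    using assms(1) by (simp add: size_multiset_overloaded_eq)
  also have "\<dots> = (\<Sum>x | poly p x = 0. 1)"
  proof (intro sum.cong refl)
    fix x assume "x \<in> {x. poly p x = 0}"
    then have "order x p \<noteq> 0" using assms(1) by (simp add: order_root)
    moreover have "order x p = 0 \<or> order x p = 1"
      using assms(2) rsquarefree_roots[of p] unfolding rsquarefree_def by blast
    ultimately show "order x p = 1" by simp
  qed
  finally show ?thesis by simp
qed

text \<open>Bertini's theorem for a pencil without base points. A multiple root of \<open>N - a B\<close> is a critical point of
  the rational function \<open>N / B\<close> with critical value \<open>a\<close>, and there are finitely many of these, because the
  numerator \<open>W = N' B - N B'\<close> of the derivative is nonzero: at a root of \<open>N\<close> its two terms have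
  different orders.\<close>

lemma pencil_member_simple_roots:
  fixes N B :: "'k::{alg_closed_field, field_char_0} poly"
  assumes "degree N > 0" "B \<noteq> 0" "\<nexists>t. poly N t = 0 \<and> poly B t = 0"
  shows "\<exists>a. \<nexists>t. poly (N - smult a B) t = 0 \<and> poly (pderiv (N - smult a B)) t = 0"
proof -
  define W where "W = pderiv N * B - N * pderiv B"
  have "W \<noteq> 0"
  proof
    assume "W = 0"
    then have eq: "pderiv N * B = N * pderiv B" by (simp add: W_def)
    have N': "pderiv N \<noteq> 0" "N \<noteq> 0" using assms(1) by (auto simp: pderiv_eq_0_iff)
    obtain t where t: "poly N t = 0" using alg_closed_imp_poly_has_root[of N] assms(1) by blast
    then have "order t B = 0" using assms(3) by (auto intro: order_0I)
    then have "order t (pderiv N * B) = order t (pderiv N)" using N' assms(2) by (simp add: order_mult)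
    moreover have "order t N = Suc (order t (pderiv N))" using t N' by (intro order_pderiv)
    moreover have "order t N \<le> order t (N * pderiv B)"
      using N' assms(2) eq by (subst order_mult) (auto simp: eq[symmetric])
    ultimately show False using eq by simp
  qed
  then have "finite ((\<lambda>t. poly N t / poly B t) ` {t. poly W t = 0})"
    by (intro finite_imageI poly_roots_finite)
  then obtain a where a: "a \<notin> (\<lambda>t. poly N t / poly B t) ` {t. poly W t = 0}"
    using ex_new_if_finite infinite_UNIV_char_0 by blast
  have False if t: "poly (N - smult a B) t = 0" "poly (pderiv (N - smult a B)) t = 0" for t
  proof -
    have 1: "poly N t = a * poly B t" using t(1) by simp
    have 2: "poly (pderiv N) t = a * poly (pderiv B) t"
      using t(2) by (simp add: pderiv_diff pderiv_smult)
    have B: "poly B t \<noteq> 0" using 1 assms(3) by auto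
    have "poly W t = 0" using 1 2 by (simp add: W_def)
    moreover have "a = poly N t / poly B t" using 1 B by simp
    ultimately show False using a by blast
  qed
  then show ?thesis by blast
qed

lemma coeff_mult_top:
  assumes "degree p \<le> m" "degree q \<le> n"
  shows "coeff (p * q) (m + n) = coeff p m * coeff q n"
proof -
  have "coeff (p * q) (m + n) = (\<Sum>i\<le>m + n. if i = m then coeff p m * coeff q n else 0)"
    unfolding coeff_mult
  proof (intro sum.cong refl)
    fix i
    have "coeff p i = 0 \<or> coeff q (m + n - i) = 0" if "i \<noteq> m"
      using that assms by (cases "i < m") (auto intro: coeff_eq_0)
    then show "coeff p i * coeff q (m + n - i) = (if i = m then coeff p m * coeff q n else 0)" by auto
  qed
  then show ?thesis by simp
qed

definition polyfam :: "'v set \<Rightarrow> (('v \<Rightarrow> 'a) \<Rightarrow> 'a::{comm_ring_1} poly) \<Rightarrow> bool" where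
  "polyfam I p \<longleftrightarrow> (\<forall>i. polyfun I (\<lambda>c. coeff (p c) i))"

lemma polyfam_const: "polyfam I (\<lambda>_. p)"
  by (auto simp: polyfam_def)

lemma polyfam_scalar: "polyfun I F \<Longrightarrow> polyfam I (\<lambda>c. [:F c:])"
  unfolding polyfam_def
proof
  fix i assume "polyfun I F"
  then show "polyfun I (\<lambda>c. coeff [:F c:] i)" by (cases i) auto
qed

lemma polyfam_smult: "polyfun I F \<Longrightarrow> polyfam I p \<Longrightarrow> polyfam I (\<lambda>c. smult (F c) (p c))"
  by (simp add: polyfam_def polyfun_mult)

lemma polyfam_diff: "polyfam I p \<Longrightarrow> polyfam I q \<Longrightarrow> polyfam I (\<lambda>c. p c - q c)"
  by (simp add: polyfam_def polyfun_diff)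

lemma polyfam_sum: "(\<And>i. i \<in> S \<Longrightarrow> polyfam I (p i)) \<Longrightarrow> polyfam I (\<lambda>c. \<Sum>i\<in>S. p i c)"
  by (simp add: polyfam_def coeff_sum polyfun_sum)

lemma polyfam_mult: "polyfam I p \<Longrightarrow> polyfam I q \<Longrightarrow> polyfam I (\<lambda>c. p c * q c)"
  by (simp add: polyfam_def coeff_mult polyfun_sum polyfun_mult)

lemma polyfam_pderiv: "polyfam I p \<Longrightarrow> polyfam I (\<lambda>c. pderiv (p c :: 'a::{comm_ring_1, semiring_no_zero_divisors} poly))"
  unfolding polyfam_def coeff_pderiv by (auto intro!: polyfun_mult[OF polyfun_const])

lemmas polyfam_intros = polyfam_const polyfam_scalar polyfam_smult polyfam_diff polyfam_sum
  polyfam_mult polyfam_pderiv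

lemma polyfun_eval_polyfam:
  assumes "polyfam I p" "\<And>c. degree (p c) \<le> n"
  shows "polyfun I (\<lambda>c. poly (p c) t)"
proof -
  have "poly (p c) t = (\<Sum>i\<le>n. coeff (p c) i * t ^ i)" for c
    unfolding poly_altdef using assms(2)[of c]
    by (intro sum.mono_neutral_left) (auto simp: coeff_eq_0)
  then show ?thesis using assms(1) unfolding polyfam_def by (simp add: polyfun_intros)
qed

lemma generic_no_common_root:
  fixes p q :: "('v \<Rightarrow> 'a) \<Rightarrow> 'a::{alg_closed_field, field_char_0} poly"
  assumes "polyfam I p" "polyfam I q" "\<And>c. degree (p c) \<le> m" "\<And>c. degree (q c) \<le> n"
    and "coeff (p c0) m \<noteq> 0" "\<nexists>t. poly (p c0) t = 0 \<and> poly (q c0) t = 0"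
  shows "generic I (\<lambda>c. \<nexists>t. poly (p c) t = 0 \<and> poly (q c) t = 0)"
proof -
  have "degree (p c0) = m" using assms(3)[of c0] le_degree[OF assms(5)] by simp
  moreover have "p c0 \<noteq> 0" using assms(5) by auto
  ultimately have "\<exists>F. polyfun I F \<and> F c0 \<noteq> 0 \<and>
    (\<forall>c. F c \<noteq> 0 \<longrightarrow> (\<nexists>t. poly (p c) t = 0 \<and> poly (q c) t = 0))"
    using assms by (intro elimination[where n = n]) (auto simp: polyfam_def)
  then show ?thesis unfolding generic_def by blast
qed

text \<open>All three conditions are open, and they may be checked separately: simplicity of the roots at \<open>c0\<close>, and
  avoidance of each \<open>b\<close> at a parameter that may depend on \<open>b\<close>.\<close>

lemma generic_simple_roots:
  fixes p :: "('v \<Rightarrow> 'a) \<Rightarrow> 'a::{alg_closed_field, field_char_0} poly"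
  assumes "polyfam I p" "\<And>c. degree (p c) \<le> m" and "coeff (p c0) m \<noteq> 0"
    and "\<nexists>t. poly (p c0) t = 0 \<and> poly (pderiv (p c0)) t = 0"
    and B: "finite B" "\<And>b. b \<in> B \<Longrightarrow> \<exists>c. poly (p c) b \<noteq> 0"
  shows "generic I (\<lambda>c. card {t. poly (p c) t = 0} = m \<and> finite {t. poly (p c) t = 0} \<and>
    (\<forall>b\<in>B. poly (p c) b \<noteq> 0))"
proof -
  have "generic I (\<lambda>c. coeff (p c) m \<noteq> 0)"
    using assms(1,3) by (intro generic_polyfun) (auto simp: polyfam_def)
  moreover have "generic I (\<lambda>c. \<nexists>t. poly (p c) t = 0 \<and> poly (pderiv (p c)) t = 0)"
    by (intro generic_no_common_root[OF assms(1) polyfam_pderiv[OF assms(1)] assms(2) _ assms(3,4), where n = m])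
      (metis assms(2) degree_pderiv diff_le_self order.trans)
  moreover have "generic I (\<lambda>c. \<forall>b\<in>B. poly (p c) b \<noteq> 0)"
  proof (rule generic_ball[OF B(1)])
    fix b assume "b \<in> B"
    then obtain c where "poly (p c) b \<noteq> 0" using B(2) by blast
    then show "generic I (\<lambda>c. poly (p c) b \<noteq> 0)"
      by (intro generic_polyfun[where F = "\<lambda>c. poly (p c) b"] polyfun_eval_polyfam[OF assms(1,2)])
  qed
  ultimately have "generic I (\<lambda>c. coeff (p c) m \<noteq> 0 \<and>
      (\<nexists>t. poly (p c) t = 0 \<and> poly (pderiv (p c)) t = 0) \<and> (\<forall>b\<in>B. poly (p c) b \<noteq> 0))"
    by (intro generic_conj)
  then show ?thesis
  proof (rule generic_mono)
    fix c assume c: "coeff (p c) m \<noteq> 0 \<and>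
      (\<nexists>t. poly (p c) t = 0 \<and> poly (pderiv (p c)) t = 0) \<and> (\<forall>b\<in>B. poly (p c) b \<noteq> 0)"
    then have "degree (p c) = m" "p c \<noteq> 0" using assms(2)[of c] le_degree[of "p c" m] by auto
    then show "card {t. poly (p c) t = 0} = m \<and> finite {t. poly (p c) t = 0} \<and> (\<forall>b\<in>B. poly (p c) b \<noteq> 0)"
      using c card_simple_roots[of "p c"] poly_roots_finite[of "p c"] by blast
  qed
qed

section \<open>The degree of a polynomial curve\<close>

definition max_degree :: "'k::zero poly ^ 'n \<Rightarrow> nat" where
  "max_degree g = Max (range (\<lambda>i. degree (g $ i)))"

lemma degree_le_max_degree: "degree (g $ i) \<le> max_degree g"
  unfolding max_degree_def by (intro Max_ge) auto

text \<open>A coordinate of less than maximal degree contributes \<open>0\<close>, not its leading coefficient.\<close>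

definition top_coeffs :: "'k::zero poly ^ 'n \<Rightarrow> 'k ^ 'n" where
  "top_coeffs g = (\<chi> i. coeff (g $ i) (max_degree g))"

lemma top_coeffs_nonzero:
  assumes "max_degree g > 0" shows "top_coeffs g \<noteq> 0"
proof -
  have "max_degree g \<in> range (\<lambda>i. degree (g $ i))"
    unfolding max_degree_def by (intro Max_in) auto
  then obtain i where i: "max_degree g = degree (g $ i)" by blast
  then have "top_coeffs g $ i \<noteq> 0" using assms by (auto simp: top_coeffs_def)
  then show ?thesis by auto
qed

definition lincomb :: "'k::comm_ring_1 poly ^ 'n \<Rightarrow> ('n \<Rightarrow> 'k) \<Rightarrow> 'k poly" where
  "lincomb g a = (\<Sum>i\<in>UNIV. smult (a i) (g $ i))"

lemma poly_lincomb: "poly (lincomb g a) t = (\<Sum>i\<in>UNIV. a i * poly (g $ i) t)"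
  by (simp add: lincomb_def poly_sum)

lemma degree_lincomb: "degree (lincomb g a) \<le> max_degree g"
  unfolding lincomb_def
  by (intro degree_sum_le order.trans[OF degree_smult_le] degree_le_max_degree) auto

lemma coeff_lincomb: "coeff (lincomb g a) (max_degree g) = (\<Sum>i\<in>UNIV. a i * top_coeffs g $ i)"
  by (simp add: lincomb_def coeff_sum top_coeffs_def)

lemma pderiv_lincomb: "pderiv (lincomb g a) = (\<Sum>i\<in>UNIV. smult (a i) (pderiv (g $ i)))"
  by (rule poly_eqI) (simp add: lincomb_def coeff_pderiv coeff_sum sum_distrib_left mult_ac)

lemma poly_pderiv_lincomb:
  "poly (pderiv (lincomb g a)) t = (\<Sum>i\<in>UNIV. a i * velocity g t $ i)"
  by (simp add: pderiv_lincomb poly_sum)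

lemma polyfam_lincomb:
  "(\<And>i. e i \<in> I) \<Longrightarrow> polyfam I (\<lambda>c. lincomb g (\<lambda>i. c (e i)))"
  unfolding lincomb_def by (intro polyfam_intros polyfun_var) auto

text \<open>The hyperplane with coefficients \<open>c\<close> meets the curve at the roots of \<open>p c\<close>. Keeping these roots away from
  the exceptional set \<open>B\<close> makes the corresponding points distinct.\<close>

lemma degree_curve:
  fixes g :: "'k::{alg_closed_field, field_char_0} poly ^ 'n"
  assumes D: "max_degree g > 0" and B: "finite B" and inj: "inj_on (curve_point g) (- B)"
  shows "generic ({..<1} \<times> UNIV) (\<lambda>c. finite (range (curve_point g) \<inter> linear_system 1 c) \<and>
    card (range (curve_point g) \<inter> linear_system 1 c) = max_degree g)"
proof -
  let ?D = "max_degree g"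
  define p where "p c = lincomb g (\<lambda>i. c (0::nat, Some i)) - [:c (0, None):]" for c
  have pf: "polyfam ({..<1} \<times> UNIV) p"
    unfolding p_def by (intro polyfam_diff polyfam_lincomb polyfam_scalar polyfun_var) auto
  have dp: "degree (p c) \<le> ?D" for c
    unfolding p_def by (intro degree_diff_le degree_lincomb) simp
  obtain a where a: "(\<Sum>i\<in>UNIV. a i * top_coeffs g $ i) \<noteq> 0"
    using generic_ex[OF generic_dot[OF top_coeffs_nonzero[OF D]]] by blast
  have cN: "coeff (lincomb g a) ?D \<noteq> 0" using a by (simp add: coeff_lincomb)
  then have "degree (lincomb g a) > 0" using D le_degree by fastforce
  then obtain a0 where a0: "\<nexists>t. poly (lincomb g a - smult a0 1) t = 0 \<and>
      poly (pderiv (lincomb g a - smult a0 1)) t = 0"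
    using pencil_member_simple_roots[of "lincomb g a" 1] by auto
  define c0 where "c0 = (\<lambda>(r :: nat, j). case j of None \<Rightarrow> a0 | Some i \<Rightarrow> a i)"
  have p0: "p c0 = lincomb g a - smult a0 1" by (simp add: p_def c0_def)
  have "coeff (p c0) ?D \<noteq> 0" unfolding p0 using cN D by (simp add: coeff_eq_0)
  moreover have "\<exists>c. poly (p c) b \<noteq> 0" for b
    by (intro exI[of _ "\<lambda>(r, j). case j of None \<Rightarrow> 1 | Some i \<Rightarrow> 0"]) (simp add: p_def poly_lincomb)
  ultimately have "generic ({..<1} \<times> UNIV) (\<lambda>c. card {t. poly (p c) t = 0} = ?D \<and>
      finite {t. poly (p c) t = 0} \<and> (\<forall>b\<in>B. poly (p c) b \<noteq> 0))"
    using a0 B by (intro generic_simple_roots[OF pf dp, of c0]) (simp_all add: p0)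
  then show ?thesis
  proof (rule generic_mono)
    fix c :: "nat \<times> 'n option \<Rightarrow> 'k"
    let ?S = "{t. poly (p c) t = 0}"
    assume c: "card ?S = ?D \<and> finite ?S \<and> (\<forall>b\<in>B. poly (p c) b \<noteq> 0)"
    have "range (curve_point g) \<inter> linear_system 1 c = curve_point g ` ?S"
      by (auto simp: linear_system_def p_def poly_lincomb)
    moreover have "inj_on (curve_point g) ?S" using c by (intro inj_on_subset[OF inj]) auto
    ultimately show "finite (range (curve_point g) \<inter> linear_system 1 c) \<and>
      card (range (curve_point g) \<inter> linear_system 1 c) = ?D"
      using c by (simp add: card_image)
  qed
qed

section \<open>The degree of the tangent bundle\<close>

lemma sum_UNIV_Plus:
  fixes f :: "'a::finite + 'b::finite \<Rightarrow> 'c::comm_monoid_add"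
  shows "(\<Sum>k\<in>UNIV. f k) = (\<Sum>i\<in>UNIV. f (Inl i)) + (\<Sum>i\<in>UNIV. f (Inr i))"
  unfolding UNIV_Plus_UNIV[symmetric] by (subst sum.Plus) auto

text \<open>The second combination has to be nonzero at the finitely many roots of the first, which is possible because
  the velocity vanishes nowhere.\<close>

lemma coprime_velocity_combinations:
  fixes g :: "'k::{alg_closed_field, field_char_0} poly ^ 'n"
  assumes D: "max_degree g > 0" and vel: "\<And>t. velocity g t \<noteq> 0"
  shows "\<exists>a b. (\<Sum>i\<in>UNIV. a i * top_coeffs g $ i) \<noteq> 0 \<and> (\<Sum>i\<in>UNIV. b i * top_coeffs g $ i) \<noteq> 0 \<and>
    (\<nexists>t. poly (pderiv (lincomb g a)) t = 0 \<and> poly (pderiv (lincomb g b)) t = 0)"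
proof -
  obtain a where a: "(\<Sum>i\<in>UNIV. a i * top_coeffs g $ i) \<noteq> 0"
    using generic_ex[OF generic_dot[OF top_coeffs_nonzero[OF D]]] by blast
  then have "degree (lincomb g a) > 0" using D le_degree[of "lincomb g a" "max_degree g"]
    by (simp add: coeff_lincomb)
  then have "pderiv (lincomb g a) \<noteq> 0" by (simp add: pderiv_eq_0_iff)
  then have fin: "finite {t. poly (pderiv (lincomb g a)) t = 0}" by (rule poly_roots_finite)
  have "generic UNIV (\<lambda>b. (\<Sum>i\<in>UNIV. b i * top_coeffs g $ i) \<noteq> 0 \<and>
      (\<forall>t\<in>{t. poly (pderiv (lincomb g a)) t = 0}. (\<Sum>i\<in>UNIV. b i * velocity g t $ i) \<noteq> 0))"
    by (intro generic_conj generic_ball fin generic_dot vel top_coeffs_nonzero[OF D])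
  from generic_ex[OF this] obtain b where b: "(\<Sum>i\<in>UNIV. b i * top_coeffs g $ i) \<noteq> 0"
    "\<forall>t\<in>{t. poly (pderiv (lincomb g a)) t = 0}. (\<Sum>i\<in>UNIV. b i * velocity g t $ i) \<noteq> 0" by blast
  then show ?thesis using a by (intro exI[of _ a] exI[of _ b]) (auto simp: poly_pderiv_lincomb)
qed

text \<open>Eliminating \<open>s\<close> from the two equations leaves \<open>H\<close>. Its roots correspond to the points of intersection,
  since \<open>s\<close> is determined by \<open>t\<close> when \<open>V\<^sub>0\<close> and \<open>V\<^sub>1\<close> have no common root.
  The existence of one \<open>c\<close> for which \<open>H\<close> has degree \<open>2D - 1\<close> and simple roots comes from a pencil: if the
  second equation is \<open>s V\<^sub>1 = 1\<close>, then \<open>H = N - a0 V\<^sub>1\<close> with \<open>N\<close> and \<open>V\<^sub>1\<close> coprime.\<close>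

lemma degree_tangent_surface:
  fixes g :: "'k::{alg_closed_field, field_char_0} poly ^ 'n"
  defines "TC \<equiv> {bundle_point g t s | t s. True}"
  assumes D: "max_degree g > 0" and B: "finite B" and inj: "inj_on (curve_point g) (- B)"
    and vel: "\<And>t. velocity g t \<noteq> 0"
  shows "generic ({..<2} \<times> UNIV) (\<lambda>c. finite (TC \<inter> linear_system 2 c) \<and>
    card (TC \<inter> linear_system 2 c) = 2 * max_degree g - 1)"
proof -
  let ?D = "max_degree g" and ?I = "{..<2::nat} \<times> (UNIV :: ('n + 'n) option set)"
  define A where "A r c = lincomb g (\<lambda>i. c (r, Some (Inl i))) - [:c (r, None):]"
    for r :: nat and c :: "nat \<times> ('n + 'n) option \<Rightarrow> 'k"
  define V where "V r c = pderiv (lincomb g (\<lambda>i. c (r, Some (Inr i))))"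
    for r :: nat and c :: "nat \<times> ('n + 'n) option \<Rightarrow> 'k"
  define H where "H c = A 0 c * V 1 c - A 1 c * V 0 c" for c
  have pA: "polyfam ?I (A r)" if "r < 2" for r
    using that unfolding A_def by (intro polyfam_diff polyfam_lincomb polyfam_scalar polyfun_var) auto
  have pV: "polyfam ?I (V r)" if "r < 2" for r
    using that unfolding V_def by (intro polyfam_pderiv polyfam_lincomb) auto
  have pH: "polyfam ?I H" unfolding H_def by (intro polyfam_diff polyfam_mult pA pV) auto
  have dA: "degree (A r c) \<le> ?D" for r c
    unfolding A_def by (intro degree_diff_le degree_lincomb) simp
  have dV: "degree (V r c) \<le> ?D - 1" for r c
    unfolding V_def degree_pderiv using degree_lincomb by (intro diff_le_mono)
  have D2: "2 * ?D - 1 = ?D + (?D - 1)" using D by simp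
  have dH: "degree (H c) \<le> 2 * ?D - 1" for c
    unfolding H_def D2 using dA dV
    by (intro degree_diff_le order.trans[OF degree_mult_le] add_mono)
  have coeff_V: "coeff (V r c) (?D - 1) = of_nat ?D * (\<Sum>i\<in>UNIV. c (r, Some (Inr i)) * top_coeffs g $ i)" for r c
    using D by (simp add: V_def coeff_pderiv coeff_lincomb)
  obtain a b where ab: "(\<Sum>i\<in>UNIV. a i * top_coeffs g $ i) \<noteq> 0" "(\<Sum>i\<in>UNIV. b i * top_coeffs g $ i) \<noteq> 0"
    "\<nexists>t. poly (pderiv (lincomb g a)) t = 0 \<and> poly (pderiv (lincomb g b)) t = 0"
    using coprime_velocity_combinations[OF D vel] by blast
  \<comment> \<open>The pencil of systems that share everything but the constant \<open>a0\<close> of the first equation.\<close>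
  define cc where "cc a0 = (\<lambda>(r :: nat, j).
    case j of None \<Rightarrow> (if r = 0 then a0 else 1)
    | Some (Inl i) \<Rightarrow> (if r = 0 then a i else 0)
    | Some (Inr i) \<Rightarrow> (if r = 0 then a i else b i))" for a0 :: 'k
  have lc0: "lincomb g (\<lambda>i. 0) = 0" by (simp add: lincomb_def)
  have V_cc: "V 0 (cc a0) = pderiv (lincomb g a)" "V 1 (cc a0) = pderiv (lincomb g b)" for a0
    by (simp_all add: V_def cc_def)
  have A_cc: "A 0 (cc a0) = lincomb g a - [:a0:]" "A 1 (cc a0) = - 1" for a0
    by (simp_all add: A_def cc_def lc0 one_pCons)
  have generic_V: "generic ?I (\<lambda>c. \<nexists>t. poly (V 0 c) t = 0 \<and> poly (V 1 c) t = 0)"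
  proof (rule generic_no_common_root[OF pV pV dV dV])
    show "coeff (V 0 (cc 0)) (?D - 1) \<noteq> 0" unfolding coeff_V using ab(1) D by (simp add: cc_def)
    show "\<nexists>t. poly (V 0 (cc 0)) t = 0 \<and> poly (V 1 (cc 0)) t = 0" unfolding V_cc using ab(3) .
  qed auto
  define N where "N = lincomb g a * pderiv (lincomb g b) + pderiv (lincomb g a)"
  have H_cc: "H (cc a0) = N - smult a0 (pderiv (lincomb g b))" for a0
    unfolding H_def V_cc A_cc N_def by (simp add: algebra_simps)
  have coeff_H: "coeff (H (cc a0)) (2 * ?D - 1) \<noteq> 0" for a0
  proof -
    have "coeff (H (cc a0)) (2 * ?D - 1) = coeff (A 0 (cc a0)) ?D * coeff (V 1 (cc a0)) (?D - 1) -
        coeff (A 1 (cc a0)) ?D * coeff (V 0 (cc a0)) (?D - 1)"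
      unfolding H_def D2 coeff_diff using dA dV by (simp only: coeff_mult_top)
    also have "coeff (A 1 (cc a0)) ?D = 0" unfolding A_cc using D by (simp add: coeff_eq_0)
    also have "coeff (A 0 (cc a0)) ?D = (\<Sum>i\<in>UNIV. a i * top_coeffs g $ i)"
      unfolding A_cc using D by (simp add: coeff_eq_0 coeff_lincomb)
    also have "coeff (V 1 (cc a0)) (?D - 1) = of_nat ?D * (\<Sum>i\<in>UNIV. b i * top_coeffs g $ i)"
      unfolding coeff_V by (simp add: cc_def)
    finally show ?thesis using ab(1,2) D by simp
  qed
  have "degree N > 0"
  proof -
    have "N = H (cc 0)" by (simp add: H_cc)
    then have "2 * ?D - 1 \<le> degree N" using coeff_H[of 0] by (simp add: le_degree)
    then show ?thesis using D by simp
  qed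
  moreover have "pderiv (lincomb g b) \<noteq> 0"
  proof
    assume "pderiv (lincomb g b) = 0"
    then have "coeff (V 1 (cc 0)) (?D - 1) = 0" unfolding V_cc by simp
    then show False unfolding coeff_V using ab(2) D by (simp add: cc_def)
  qed
  moreover have "\<nexists>t. poly N t = 0 \<and> poly (pderiv (lincomb g b)) t = 0"
    using ab(3) by (auto simp: N_def)
  ultimately obtain a0 where a0: "\<nexists>t. poly (H (cc a0)) t = 0 \<and> poly (pderiv (H (cc a0))) t = 0"
    using pencil_member_simple_roots[of N "pderiv (lincomb g b)"] unfolding H_cc by blast
  have "\<exists>c. poly (H c) s \<noteq> 0" for s
  proof -
    obtain v where v: "(\<Sum>i\<in>UNIV. v i * velocity g s $ i) \<noteq> 0"
      using generic_ex[OF generic_dot[OF vel[of s]]] by blast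
    \<comment> \<open>Here \<open>A\<^sub>0 = - 1\<close> and \<open>A\<^sub>1 = V\<^sub>0 = 0\<close>, so that \<open>H = - V\<^sub>1\<close>.\<close>
    define c where "c = (\<lambda>(r :: nat, j).
      case j of None \<Rightarrow> (if r = 0 then 1 else 0)
      | Some (Inl (i :: 'n)) \<Rightarrow> 0 | Some (Inr i) \<Rightarrow> (if r = 0 then 0 else v i))"
    have "H c = - pderiv (lincomb g v)"
      by (simp add: H_def A_def V_def c_def lc0 flip: one_pCons)
    then show ?thesis using v by (intro exI[of _ c]) (simp add: poly_pderiv_lincomb del: velocity_nth)
  qed
  then have "generic ?I (\<lambda>c. card {t. poly (H c) t = 0} = 2 * ?D - 1 \<and> finite {t. poly (H c) t = 0} \<and>
      (\<forall>b\<in>B. poly (H c) b \<noteq> 0))"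
    using coeff_H a0 B by (intro generic_simple_roots[OF pH dH, of "cc a0"]) auto
  from generic_conj[OF this generic_V] show ?thesis
  proof (rule generic_mono)
    fix c :: "nat \<times> ('n + 'n) option \<Rightarrow> 'k"
    let ?S = "{t. poly (H c) t = 0}"
    assume c: "(card ?S = 2 * ?D - 1 \<and> finite ?S \<and> (\<forall>b\<in>B. poly (H c) b \<noteq> 0)) \<and>
      (\<nexists>t. poly (V 0 c) t = 0 \<and> poly (V 1 c) t = 0)"
    define \<sigma> where "\<sigma> t = (if poly (V 0 c) t \<noteq> 0 then - poly (A 0 c) t / poly (V 0 c) t
      else - poly (A 1 c) t / poly (V 1 c) t)" for t
    have mem: "bundle_point g t s \<in> linear_system 2 c \<longleftrightarrow> poly (H c) t = 0 \<and> s = \<sigma> t" for t s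
    proof -
      have "bundle_point g t s \<in> linear_system 2 c \<longleftrightarrow> (\<forall>r<2. poly (A r c) t + s * poly (V r c) t = 0)"
        unfolding linear_system_def mem_Collect_eq sum_UNIV_Plus bundle_point_nth
        by (simp add: A_def V_def poly_lincomb poly_pderiv_lincomb sum_distrib_left algebra_simps)
      also have "\<dots> \<longleftrightarrow> poly (A 0 c) t + s * poly (V 0 c) t = 0 \<and> poly (A 1 c) t + s * poly (V 1 c) t = 0"
        by (auto simp: less_2_cases_iff)
      also have "\<dots> \<longleftrightarrow> poly (H c) t = 0 \<and> s = \<sigma> t"
      proof -
        have *: "(A0 + s * V0 = 0 \<and> A1 + s * V1 = 0) \<longleftrightarrow>
            (A0 * V1 - A1 * V0 = 0 \<and> s = (if V0 \<noteq> 0 then - A0 / V0 else - A1 / V1))"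
          if "\<not> (V0 = 0 \<and> V1 = 0)" for A0 A1 V0 V1 :: 'k
        proof (cases "V0 = 0")
          case True
          then show ?thesis using that by (auto simp: field_simps eq_neg_iff_add_eq_0)
        next
          case False
          have "A0 + s * V0 = 0 \<longleftrightarrow> s = - A0 / V0" using False by (auto simp: field_simps eq_neg_iff_add_eq_0)
          moreover have "A1 + s * V1 = 0 \<longleftrightarrow> A0 * V1 - A1 * V0 = 0" if "s = - A0 / V0"
          proof -
            have "A0 = - (s * V0)" using that False by simp
            then have "A0 * V1 - A1 * V0 = - V0 * (A1 + s * V1)" by (simp add: algebra_simps)
            then show ?thesis using False by auto
          qed
          ultimately show ?thesis using False by auto
        qed
        show ?thesis unfolding H_def \<sigma>_def using *[of "poly (V 0 c) t" "poly (V 1 c) t"] c by auto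
      qed
      finally show ?thesis .
    qed
    have "TC \<inter> linear_system 2 c = (\<lambda>t. bundle_point g t (\<sigma> t)) ` ?S"
      unfolding TC_def using mem by auto
    moreover have "inj_on (\<lambda>t. bundle_point g t (\<sigma> t)) ?S"
    proof (rule inj_onI)
      fix t t' assume t: "t \<in> ?S" "t' \<in> ?S" and eq: "bundle_point g t (\<sigma> t) = bundle_point g t' (\<sigma> t')"
      have "bundle_point g t (\<sigma> t) $ Inl i = bundle_point g t' (\<sigma> t') $ Inl i" for i using eq by simp
      then have "curve_point g t = curve_point g t'" by (simp add: vec_eq_iff)
      moreover have "t \<in> - B" "t' \<in> - B" using t c by auto
      ultimately show "t = t'" using inj by (auto dest: inj_onD)
    qed
    ultimately show "finite (TC \<inter> linear_system 2 c) \<and> card (TC \<inter> linear_system 2 c) = 2 * ?D - 1"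
      using c by (simp add: card_image)
  qed
qed

section \<open>The degree formula\<close>

lemma finite_complement_of_open_line:
  fixes U :: "('k::field_char_0 ^ 1) set"
  assumes "openin zariski U" "U \<noteq> {}"
  shows "finite {s. vec s \<notin> U}"
proof -
  obtain S where S: "U = - zero_set S" using assms(1) openin_zariski by blast
  then obtain t f where f: "f \<in> S" "mpoly_eval f (($) t) \<noteq> 0" using assms(2) by (auto simp: zero_set_def)
  let ?p = "pull (\<lambda>_. [:0, 1:]) f"
  have ev: "poly ?p s = mpoly_eval f (($) (vec s))" for s
    unfolding poly_pull by (intro arg_cong[of _ _ "mpoly_eval f"]) (simp add: fun_eq_iff)
  have "vec (t $ 1) = t" by (simp add: vec_eq_iff forall_1)
  then have "?p \<noteq> 0" using ev[of "t $ 1"] f(2) by auto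
  then have "finite {s. poly ?p s = 0}" by (rule poly_roots_finite)
  moreover have "{s. vec s \<notin> U} \<subseteq> {s. poly ?p s = 0}" using S f(1) ev by (auto simp: zero_set_def)
  ultimately show ?thesis by (rule rev_finite_subset)
qed

theorem theorem25:
  fixes C :: "('k::{alg_closed_field, field_char_0} ^ 'n) set"
    and g :: "'k poly ^ 'n"
    and U :: "('k ^ 1) set"
  assumes "smooth_curve C"
    and "polynomial_parametrization g C"
    and "openin zariski U" and "U \<noteq> {}"
    and "inj_on (param g) U"
    and "\<forall>t\<in>U. param_deriv g t \<noteq> 0"
  shows "int (geometric_degree (tangent_bundle C)) = 2 * int (geometric_degree C) - 1"
proof -
  have param: "param g t = curve_point g (t $ 1)" for t by (simp add: param_def curve_point_def)
  have "curve_point g s \<in> range (param g)" for s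
    by (rule image_eqI[of _ _ "vec s"]) (simp_all add: param)
  then have range: "range (param g) = range (curve_point g)" using param by auto
  have clos: "zariski closure_of range (curve_point g) = C"
    using assms(2) unfolding polynomial_parametrization_def range by blast
  have dimC: "dimension C = 1" and smooth: "\<And>p. p \<in> C \<Longrightarrow> enat (vec.dim (tangent_space C p)) = local_dimension C p"
    using assms(1) unfolding smooth_curve_def smooth_variety_def by auto
  have "\<exists>i0. degree (g $ i0) > 0"
  proof (rule ccontr)
    assume "\<not> ?thesis"
    then have "\<exists>a. g $ i = [:a:]" for i using degree_eq_zeroE[of "g $ i"] by blast
    then have "poly (g $ i) t = poly (g $ i) 0" for i t by (metis mult_zero_right poly_0 poly_pCons)
    then have "curve_point g t = curve_point g 0" for t by (simp add: vec_eq_iff)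
    then have "range (curve_point g) = {curve_point g 0}" by auto
    then have "C = {curve_point g 0}" using clos closedin_point closure_of_closedin by metis
    then show False using dimC dimension_point[of "curve_point g 0"] by simp
  qed
  then obtain i0 where i0: "degree (g $ i0) > 0" by blast
  then have D: "max_degree g > 0" using degree_le_max_degree[of g i0] by simp
  have clC: "closedin zariski (range (curve_point g))" by (rule closed_curve_image[OF i0])
  then have C: "C = range (curve_point g)" using clos closure_of_closedin by metis
  have eqC: "range (curve_point g) = range (\<lambda>c :: unit \<Rightarrow> 'k. curve_point g (c ()))"
  proof -
    have "curve_point g s \<in> range (\<lambda>c :: unit \<Rightarrow> 'k. curve_point g (c ()))" for s
      by (rule image_eqI[of _ _ "\<lambda>_. s"]) auto
    then show ?thesis by auto
  qed
  have irrC: "irreducible_variety C"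
    unfolding C eqC
  proof (rule irreducible_image)
    show "polyfun UNIV (\<lambda>c :: unit \<Rightarrow> 'k. curve_point g (c ()) $ i)" for i
      by (auto intro!: polyfun_poly polyfun_var)
  qed (use clC eqC in simp)
  define B where "B = {s. vec s \<notin> U}"
  have B: "finite B" unfolding B_def by (rule finite_complement_of_open_line[OF assms(3,4)])
  have inj: "inj_on (curve_point g) (- B)"
  proof (rule inj_onI)
    fix s t assume "s \<in> - B" "t \<in> - B" "curve_point g s = curve_point g t"
    then have "param g (vec s) = param g (vec t)" "vec s \<in> U" "vec t \<in> U" by (auto simp: param B_def)
    then have "vec s = (vec t :: 'k ^ 1)" using assms(5) by (auto dest: inj_onD)
    then show "s = t" by (simp add: vec_eq_iff)
  qed
  have dim1: "vec.dim (tangent_space (range (curve_point g)) (curve_point g t)) = 1" for t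
    using smooth[of "curve_point g t"] local_dimension_irreducible[OF irrC, of "curve_point g t"] dimC
    unfolding C by (simp add: one_enat_def)
  have vel: "velocity g t \<noteq> 0" for t
    using immersion_at_smooth_point[OF i0 B inj dim1[of t]] by (auto simp: vec_eq_iff)
  define TC where "TC = {bundle_point g t s | t s. True}"
  have TC: "tangent_bundle C = TC" unfolding C TC_def by (rule tangent_bundle_curve[OF dim1 vel])
  have clTC: "closedin zariski TC" using closedin_tangent_bundle[of C] clC unfolding TC[symmetric] C by simp
  have "geometric_degree C = max_degree g"
    using dimC degree_curve[OF D B inj] generic_affine_1
    unfolding C[symmetric] by (intro geometric_degree_eqI[OF irrC]) (auto simp: one_enat_def)
  moreover have "geometric_degree (tangent_bundle C) = 2 * max_degree g - 1"
    unfolding TC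
  proof (rule geometric_degree_eqI)
    show "irreducible_variety TC" using irreducible_tangent_bundle clTC unfolding TC_def .
    show "dimension TC = enat 2"
      using dimension_tangent_bundle[OF clTC[unfolded TC_def] i0 vel dim1] unfolding TC_def
      by (simp add: numeral_eq_enat)
    show "generic ({..<2} \<times> UNIV) (\<lambda>c. finite (TC \<inter> linear_system 2 c) \<and>
        card (TC \<inter> linear_system 2 c) = 2 * max_degree g - 1)"
      unfolding TC_def by (rule degree_tangent_surface[OF D B inj vel])
    show "generic ({..<2} \<times> UNIV) (\<lambda>c. affine_linear_variety (CARD('n + 'n) - 2)
        (linear_system 2 c :: ('k ^ ('n + 'n)) set))"
      by (rule generic_affine_2[of "Inl i0" "Inr i0"]) simp
  qed
  ultimately show ?thesis using D by simp
qed

end
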